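(* Let $p\ge0$, $q\ge1$ be integers. The unitary map $U_{p,q}:L^{2}(\mathbb{R}^{p+1},dx)\otimes\mathbb{C}_{p+q}\to\mathcal{GSM}L^{2}(\mathbb{R}^{p+q+1},d\mu)$ induces a representation on the Hilbert space $\mathcal{GSM}L^{2}(\mathbb{R}^{p+q+1},d\mu)$ by $$U_{p,q}\circ(X-iP)\circ U_{p,q}^{-1}[f](\boldsymbol{x})=CK[xf(x)](\boldsymbol{x}),\qquad \boldsymbol{x}\in\mathbb{R}^{p+q+1},$$ for every $f\in\mathcal{GSM}L^{2}(\mathbb{R}^{p+q+1},d\mu)$ such that $U_{p,q}^{-1}[f]$ lies in the domain of $X-iP$. Here, on the right-hand side, $xf(x)$ denotes the function $\mathbb{R}^{p+1}\ni x\mapsto x\,f(x)$ (left Clifford multiplication by the paravector $x$ of the restriction of $f$ to $\mathbb{R}^{p+1}$).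
   Context: Clifford algebra: $\mathbb{R}_{p+q}$ is the real Clifford algebra generated by $e_1,\dots,e_{p+q}$ with $e_ie_j+e_je_i=-2\delta_{ij}$; $e_0=1$; $\mathbb{C}_{p+q}=\mathbb{R}_{p+q}\otimes\mathbb{C}$, with elements $\lambda=\sum_A\lambda_Ae_A$, $\lambda_A\in\mathbb{C}$, $A\subseteq\{1,\dots,p+q\}$, and scalar part $Sc(\lambda)=\lambda_\emptyset$. The imaginary unit $i\in\mathbb{C}$ commutes with all $e_j$. Hermitian conjugation: $\lambda^\dagger=\sum_A\lambda_A^c\,\overline{e_A}$, where $\cdot^c$ is complex conjugation and $\overline{e_{j_1}\cdots e_{j_r}}=(-e_{j_r})\cdots(-e_{j_1})$. Inner product: $(\lambda,\mu)=Sc(\lambda^\dagger\mu)$. Points $\boldsymbol{x}\in\mathbb{R}^{p+q+1}$ are written $\boldsymbol{x}=x+\underline{y}$ with $x=\sum_{i=0}^px_ie_i\in\mathbb{R}^{p+1}$, $\underline{y}=\sum_{i=p+1}^{p+q}x_ie_i\in\mathbb{R}^q$. $D_x=\sum_{i=0}^pe_i\partial_{x_i}$. $\mathbb{S}$ is the unit sphere of $\mathbb{R}^q$, $|\mathbb{S}|=2\pi^{q/2}/\Gamma(q/2)$. $\mathcal{GSM}(\mathbb{R}^{p+q+1})$ (generalized partial-slice monogenic functions): functions $f:\mathbb{R}^{p+q+1}\to\mathbb{C}_{p+q}$ such that for every $\underline{\omega}\in\mathbb{S}$ the restriction $(x,r)\mapsto f(x+r\underline{\omega})$, $(x,r)\in\mathbb{R}^{p+1}\times\mathbb{R}$,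 has continuous first partial derivatives and satisfies $(D_x+\underline{\omega}\partial_r)f(x+r\underline{\omega})=0$. CK-extension: for a real analytic $f_0$, $CK[f_0](x+\underline{y})=\sum_{k=0}^\infty\frac1{k!}(\underline{y}D_x)^kf_0(x)$. $e(\boldsymbol{x},\xi)=CK[e^{i\langle\cdot,\xi\rangle}](\boldsymbol{x})$ for $\xi\in\mathbb{R}^{p+1}$. Segal-Bargmann transform: $$U_{p,q}[f](\boldsymbol{x})=\frac{1}{(2\pi)^{p+1}}\int_{\mathbb{R}^{p+1}}\Big(\int_{\mathbb{R}^{p+1}}e(\boldsymbol{x},\xi)e^{-|\xi|^2/2}e^{-i\langle\zeta,\xi\rangle}d\xi\Big)f(\zeta)\,d\zeta .$$ Measure: $d\mu(\boldsymbol{x})=\frac{2}{\sqrt\pi}\frac{1}{|\mathbb{S}|}\frac{e^{-|\underline{y}|^2}}{|\underline{y}|^{q-1}}\,dx\,d\underline{y}$; $\mathcal{GSM}L^2(\mathbb{R}^{p+q+1},d\mu)=\mathcal{GSM}(\mathbb{R}^{p+q+1})\cap(L^2(\mathbb{R}^{p+q+1},d\mu)\otimes\mathbb{C}_{p+q})$. $L^2$-spaces of $\mathbb{C}_{p+q}$-valued functions carry the inner product $\langle F,G\rangle=\int(F,G)$. The map $U_{p,q}$ is a unitary isomorphism from $L^{2}(\mathbb{R}^{p+1},dx)\otimes\mathbb{C}_{p+q}$ onto $\mathcal{GSM}L^2(\mathbb{R}^{p+q+1},d\mu)$. Position and momentum: $X_k[f](x)=x_kf(x)$, $P_k[f](x)=-i\,\partial_{x_k}f(x)$,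 $k=0,\dots,p$, are densely defined unbounded self-adjoint operators in $L^2(\mathbb{R}^{p+1},dx)$. On $L^2(\mathbb{R}^{p+1},dx)\otimes\mathbb{C}_{p+q}$ define $X[f](x)=\sum_{k=0}^pe_kX_k[f](x)=xf(x)$ and $P[f](x)=\sum_{k=0}^pe_kP_k[f](x)=-iD_xf(x)$; these are unbounded, and the domain of $X-iP$ is the intersection of the domains of all $X_k$ and $P_k$ (acting componentwise). *)

theory Defs
  imports "HOL-Analysis.Analysis"
begin

text \<open>
  Dimensions. The type \<open>'n\<close> indexes the coordinates \<open>0, \<dots>, p\<close> and \<open>'q\<close> the coordinates
  \<open>p + 1, \<dots>, p + q\<close>, so \<open>CARD('n) = p + 1\<close> and \<open>CARD('q) = q\<close>; since types are nonempty, this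
  covers exactly \<open>p \<ge> 0\<close> and \<open>q \<ge> 1\<close>. The index \<open>0\<close> is the least element of \<open>'n\<close>. A point
  \<open>x + y\<close> of the (p+q+1)-dimensional space is the pair \<open>(x, y)\<close>.
\<close>

type_synonym 'n rvec = "(real, 'n) vec"

type_synonym ('n, 'q) point = "'n rvec \<times> 'q rvec"

section \<open>The complex Clifford algebra\<close>

text \<open>The generators \<open>e\<^sub>1, \<dots>, e\<^sub>p\<^sub>+\<^sub>q\<close>: all indices except \<open>0\<close>.\<close>

typedef (overloaded) ('n::"{finite,linorder}", 'q::"{finite,linorder}") gen =
  "{j :: 'n + 'q. j \<noteq> Inl (Min UNIV)}"
  by (rule exI[of _ "Inr undefined"]) simp

instance gen :: ("{finite,linorder}", "{finite,linorder}") finite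
proof
  have "inj (Rep_gen :: ('a, 'b) gen \<Rightarrow> _)"
    by (simp add: Rep_gen_inject inj_on_def)
  then show "finite (UNIV :: ('a, 'b) gen set)"
    by (rule finite_imageD[rotated]) (rule finite)
qed

instantiation gen :: ("{finite,linorder}", "{finite,linorder}") linorder
begin

definition less_eq_gen :: "('a, 'b) gen \<Rightarrow> ('a, 'b) gen \<Rightarrow> bool" where
  "i \<le> j \<longleftrightarrow> (case (Rep_gen i, Rep_gen j) of
      (Inl a, Inl b) \<Rightarrow> a \<le> b | (Inl a, Inr b) \<Rightarrow> True
    | (Inr a, Inl b) \<Rightarrow> False | (Inr a, Inr b) \<Rightarrow> a \<le> b)"

definition less_gen :: "('a, 'b) gen \<Rightarrow> ('a, 'b) gen \<Rightarrow> bool" where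
  "i < j \<longleftrightarrow> i \<le> j \<and> \<not> j \<le> (i :: ('a, 'b) gen)"

instance
  by standard
    (auto simp: less_eq_gen_def less_gen_def Rep_gen_inject[symmetric] split: sum.splits)

end

lemma card_gen:
  "CARD(('n::{finite,linorder}, 'q::{finite,linorder}) gen) = (CARD('n) - 1) + CARD('q)"
proof -
  interpret type_definition "Rep_gen :: ('n, 'q) gen \<Rightarrow> _" Abs_gen
    "{j :: 'n + 'q. j \<noteq> Inl (Min UNIV)}"
    by (rule type_definition_gen)
  have "{j :: 'n + 'q. j \<noteq> Inl (Min UNIV)} = UNIV - {Inl (Min UNIV)}"
    by auto
  then have "CARD(('n, 'q) gen) = CARD('n + 'q) - 1"
    by (simp add: card card_Diff_singleton)
  then show ?thesis
    using zero_less_card_finite[where 'a='n] by simp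
qed

text \<open>
  An element is the family of its coefficients on the blades \<open>e\<^sub>A\<close>, where \<open>A\<close> ranges over the sets
  of generators (in increasing order). Warning: the library's \<open>*\<close> on this type is componentwise;
  the Clifford product is \<open>\<odot>\<close> below, and \<open>c *s \<lambda>\<close> is multiplication by a complex scalar. The norm
  of the type satisfies \<open>(norm \<lambda>)\<^sup>2 = (\<Sum>A. \<bar>\<lambda>\<^sub>A\<bar>\<^sup>2)\<close>, the scalar part of \<open>\<lambda>\<^sup>\<dagger> \<lambda>\<close>.
\<close>

type_synonym ('n, 'q) cliff = "complex ^ (('n, 'q) gen set)"

definition blade :: "('n::{finite,linorder}, 'q::{finite,linorder}) gen set \<Rightarrow> ('n, 'q) cliff" where
  "blade A = axis A 1"

text \<open>
  Sorting the word \<open>e\<^sub>A e\<^sub>B\<close> takes one transposition for each pair \<open>a \<in> A\<close>, \<open>b \<in> B\<close> with \<open>b < a\<close>,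
  and each common generator then contributes \<open>e\<^sub>j\<^sup>2 = -1\<close>.
\<close>

definition blade_sign ::
  "('n::{finite,linorder}, 'q::{finite,linorder}) gen set \<Rightarrow> ('n, 'q) gen set \<Rightarrow> complex" where
  "blade_sign A B = (-1) ^ (card {(a, b). a \<in> A \<and> b \<in> B \<and> b < a} + card (A \<inter> B))"

definition cmult ::
  "('n::{finite,linorder}, 'q::{finite,linorder}) cliff \<Rightarrow> ('n, 'q) cliff \<Rightarrow> ('n, 'q) cliff"
  (infixl "\<odot>" 70) where
  "l \<odot> m = (\<Sum>A\<in>UNIV. \<Sum>B\<in>UNIV. (blade_sign A B * l $ A * m $ B) *s blade ((A - B) \<union> (B - A)))"

lemma blade_mult: "blade A \<odot> blade B = blade_sign A B *s blade ((A - B) \<union> (B - A))"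
proof -
  have "blade A \<odot> blade B = (\<Sum>A'\<in>UNIV. \<Sum>B'\<in>UNIV. if A' = A then if B' = B
     then blade_sign A B *s blade ((A - B) \<union> (B - A)) else 0 else 0)"
    unfolding cmult_def by (intro sum.cong refl) (auto simp: blade_def axis_def)
  also have "\<dots> = (\<Sum>A'\<in>UNIV. if A' = A
     then blade_sign A B *s blade ((A - B) \<union> (B - A)) else 0)"
    by (intro sum.cong refl) simp
  finally show ?thesis by simp
qed

lemma clifford_relation:
  "blade {i} \<odot> blade {j} + blade {j} \<odot> blade {i} = (if i = j then (-2) *s blade {} else 0)"
proof -
  have inv: "{(a, b). a \<in> {k} \<and> b \<in> {l} \<and> b < a} = (if l < k then {(k, l)} else {})"
    for k l :: "('a, 'b) gen" by auto
  show ?thesis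
  proof (cases "i = j")
    case True
    have "blade_sign {j} {j} = -1" unfolding blade_sign_def inv by simp
    then show ?thesis using True by (simp add: blade_mult vec_eq_iff)
  next
    case False
    have "blade_sign {i} {j} = - blade_sign {j} {i}"
      using False unfolding blade_sign_def inv by (auto simp: not_less)
    moreover have "{j} - {i} \<union> ({i} - {j}) = {i} - {j} \<union> ({j} - {i})" by auto
    ultimately show ?thesis using False by (simp add: blade_mult vec_eq_iff)
  qed
qed

definition scal :: "complex \<Rightarrow> ('n::{finite,linorder}, 'q::{finite,linorder}) cliff" where
  "scal c = c *s blade {}"

text \<open>\<open>e_x k\<close> is \<open>e\<^sub>k\<close> for \<open>0 \<le> k \<le> p\<close> (with \<open>e\<^sub>0 = 1\<close>), \<open>e_y j\<close> is \<open>e\<^sub>j\<close> for \<open>p < j \<le> p + q\<close>.\<close>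

definition e_x :: "'n::{finite,linorder} \<Rightarrow> ('n, 'q::{finite,linorder}) cliff" where
  "e_x k = (if k = Min UNIV then scal 1 else blade {Abs_gen (Inl k)})"

definition e_y :: "'q::{finite,linorder} \<Rightarrow> ('n::{finite,linorder}, 'q) cliff" where
  "e_y j = blade {Abs_gen (Inr j)}"

definition paravec :: "('n::{finite,linorder}) rvec \<Rightarrow> ('n, 'q::{finite,linorder}) cliff" where
  "paravec x = (\<Sum>k\<in>UNIV. x $ k *\<^sub>R e_x k)"

definition yvec :: "('q::{finite,linorder}) rvec \<Rightarrow> ('n::{finite,linorder}, 'q) cliff" where
  "yvec y = (\<Sum>j\<in>UNIV. y $ j *\<^sub>R e_y j)"

section \<open>Derivatives and real analytic functions\<close>

definition ddir :: "'a::real_normed_vector \<Rightarrow> ('a \<Rightarrow> 'b::real_normed_vector) \<Rightarrow> 'a \<Rightarrow> 'b" where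
  "ddir v F x = vector_derivative (\<lambda>t. F (x + t *\<^sub>R v)) (at 0)"

abbreviation partial :: "'n::finite \<Rightarrow> ('n rvec \<Rightarrow> 'b::real_normed_vector) \<Rightarrow> 'n rvec \<Rightarrow> 'b" where
  "partial k \<equiv> ddir (axis k 1)"

definition continuous_partials ::
  "('a::euclidean_space \<Rightarrow> 'b::real_normed_vector) \<Rightarrow> bool" where
  "continuous_partials F \<longleftrightarrow> (\<forall>v\<in>Basis.
     (\<forall>x. (\<lambda>t. F (x + t *\<^sub>R v)) differentiable (at (0::real))) \<and> continuous_on UNIV (ddir v F))"

definition real_analytic :: "(('n::finite) rvec \<Rightarrow> 'b::real_normed_vector) \<Rightarrow> bool" where
  "real_analytic F \<longleftrightarrow> (\<forall>a. \<exists>r>0. \<exists>c. \<forall>x\<in>ball a r.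
     ((\<lambda>\<alpha>. (\<Prod>k\<in>UNIV. (x $ k - a $ k) ^ \<alpha> k) *\<^sub>R c \<alpha>) has_sum F x) UNIV)"

definition D_x :: "(('n::{finite,linorder}) rvec \<Rightarrow> ('n, 'q::{finite,linorder}) cliff)
    \<Rightarrow> 'n rvec \<Rightarrow> ('n, 'q) cliff" where
  "D_x F x = (\<Sum>k\<in>UNIV. e_x k \<odot> partial k F x)"

section \<open>Generalized partial-slice monogenic functions\<close>

text \<open>
  On the slice of \<open>\<omega>\<close> the function is \<open>F (x, r) = f (x + r \<omega>)\<close>; the first summand of the equation
  is \<open>D\<^sub>x\<close> in the variables \<open>x\<close>, the second \<open>\<omega> \<partial>\<^sub>r\<close>.
\<close>

definition GSM ::
  "(('n, 'q) point \<Rightarrow> ('n::{finite,linorder}, 'q::{finite,linorder}) cliff) set" where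
  "GSM = {f. \<forall>\<omega>\<in>sphere 0 1. let F = (\<lambda>(x, r). f (x, r *\<^sub>R \<omega>)) in
     continuous_partials F \<and>
     (\<forall>z. (\<Sum>k\<in>UNIV. e_x k \<odot> ddir (axis k 1, 0) F z) + yvec \<omega> \<odot> ddir (0, 1) F z = 0)}"

definition sphere_area :: "'q::finite itself \<Rightarrow> real" where
  "sphere_area _ = 2 * pi powr (real CARD('q) / 2) / Gamma (real CARD('q) / 2)"

definition \<mu> :: "(('n::finite, 'q::finite) point) measure" where
  "\<mu> = density lborel (\<lambda>(x, y). ennreal
     (2 / sqrt pi * (1 / sphere_area TYPE('q)) * (exp (- (norm y)\<^sup>2) / norm y ^ (CARD('q) - 1))))"

definition L2 :: "'a measure \<Rightarrow> ('a \<Rightarrow> complex) set" where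
  "L2 M = {f \<in> borel_measurable M. integrable M (\<lambda>x. (norm (f x))\<^sup>2)}"

text \<open>
  The tensor product of \<open>L\<^sup>2(M)\<close> with the Clifford algebra: all components are square integrable.
  Here and below, elements of \<open>L\<^sup>2\<close> spaces are represented by functions; nothing depends on the
  choice of the representative.
\<close>

definition L2C :: "'a measure \<Rightarrow> ('a \<Rightarrow> ('n::{finite,linorder}, 'q::{finite,linorder}) cliff) set" where
  "L2C M = {f. \<forall>A. (\<lambda>x. f x $ A) \<in> L2 M}"

definition GSML2 ::
  "(('n, 'q) point \<Rightarrow> ('n::{finite,linorder}, 'q::{finite,linorder}) cliff) set" where
  "GSML2 = GSM \<inter> L2C \<mu>"

section \<open>CK-extension and Segal-Bargmann transform\<close>

definition CK_term :: "('n rvec \<Rightarrow> ('n::{finite,linorder}, 'q::{finite,linorder}) cliff)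
    \<Rightarrow> ('n, 'q) point \<Rightarrow> nat \<Rightarrow> ('n, 'q) cliff" where
  "CK_term f0 = (\<lambda>(x, y) k. (1 / fact k) *\<^sub>R (((\<lambda>F u. yvec y \<odot> D_x F u) ^^ k) f0) x)"

definition CK :: "('n rvec \<Rightarrow> ('n::{finite,linorder}, 'q::{finite,linorder}) cliff)
    \<Rightarrow> ('n, 'q) point \<Rightarrow> ('n, 'q) cliff" where
  "CK f0 z = (\<Sum>k. CK_term f0 z k)"

definition e_fun :: "('n, 'q) point \<Rightarrow> 'n rvec
    \<Rightarrow> ('n::{finite,linorder}, 'q::{finite,linorder}) cliff" where
  "e_fun z \<xi> = CK (\<lambda>x. scal (exp (\<i> * complex_of_real (x \<bullet> \<xi>)))) z"

definition SB :: "('n rvec \<Rightarrow> ('n::{finite,linorder}, 'q::{finite,linorder}) cliff)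
    \<Rightarrow> ('n, 'q) point \<Rightarrow> ('n, 'q) cliff" where
  "SB g z = (1 / (2 * pi) ^ CARD('n)) *\<^sub>R
     (\<integral>\<zeta>. (\<integral>\<xi>. (complex_of_real (exp (- (norm \<xi>)\<^sup>2 / 2)) * exp (- \<i> * complex_of_real (\<zeta> \<bullet> \<xi>)))
            *s e_fun z \<xi> \<partial>lborel) \<odot> g \<zeta> \<partial>lborel)"

section \<open>Position and momentum operators\<close>

definition test_function :: "(('n::finite) rvec \<Rightarrow> real) \<Rightarrow> bool" where
  "test_function \<phi> \<longleftrightarrow> (\<forall>ks x. foldr partial ks \<phi> differentiable (at x)) \<and>
     compact (closure {x. \<phi> x \<noteq> 0})"

definition weak_partial :: "'n::finite \<Rightarrow> ('n rvec \<Rightarrow> complex) \<Rightarrow> ('n rvec \<Rightarrow> complex) \<Rightarrow> bool" where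
  "weak_partial k u v \<longleftrightarrow> (\<forall>\<phi>. test_function \<phi> \<longrightarrow>
     (\<integral>x. u x * complex_of_real (partial k \<phi> x) \<partial>lborel)
       = - (\<integral>x. v x * complex_of_real (\<phi> x) \<partial>lborel))"

text \<open>
  \<open>X\<^sub>k\<close> and \<open>P\<^sub>k\<close> on scalar functions, with the domains on which they are self-adjoint; in the domain
  of \<open>P\<^sub>k\<close> the derivative is the weak one, which is unique up to null sets.
\<close>

definition X_op :: "'n::finite \<Rightarrow> ('n rvec \<Rightarrow> complex) \<Rightarrow> 'n rvec \<Rightarrow> complex" where
  "X_op k u x = complex_of_real (x $ k) * u x"

definition dom_X :: "'n::finite \<Rightarrow> ('n rvec \<Rightarrow> complex) set" where
  "dom_X k = {u \<in> L2 lborel. X_op k u \<in> L2 lborel}"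

definition P_op :: "'n::finite \<Rightarrow> ('n rvec \<Rightarrow> complex) \<Rightarrow> 'n rvec \<Rightarrow> complex" where
  "P_op k u x = - \<i> * (SOME v. v \<in> L2 lborel \<and> weak_partial k u v) x"

definition dom_P :: "'n::finite \<Rightarrow> ('n rvec \<Rightarrow> complex) set" where
  "dom_P k = {u \<in> L2 lborel. \<exists>v \<in> L2 lborel. weak_partial k u v}"

definition componentwise :: "(('n rvec \<Rightarrow> complex) \<Rightarrow> 'n rvec \<Rightarrow> complex)
    \<Rightarrow> ('n rvec \<Rightarrow> ('n::{finite,linorder}, 'q::{finite,linorder}) cliff)
    \<Rightarrow> 'n rvec \<Rightarrow> ('n, 'q) cliff" where
  "componentwise T g x = (\<chi> A. T (\<lambda>u. g u $ A) x)"

definition X_cl :: "('n rvec \<Rightarrow> ('n::{finite,linorder}, 'q::{finite,linorder}) cliff)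
    \<Rightarrow> 'n rvec \<Rightarrow> ('n, 'q) cliff" where
  "X_cl g x = (\<Sum>k\<in>UNIV. e_x k \<odot> componentwise (X_op k) g x)"

definition P_cl :: "('n rvec \<Rightarrow> ('n::{finite,linorder}, 'q::{finite,linorder}) cliff)
    \<Rightarrow> 'n rvec \<Rightarrow> ('n, 'q) cliff" where
  "P_cl g x = (\<Sum>k\<in>UNIV. e_x k \<odot> componentwise (P_op k) g x)"

definition X_minus_iP :: "('n rvec \<Rightarrow> ('n::{finite,linorder}, 'q::{finite,linorder}) cliff)
    \<Rightarrow> 'n rvec \<Rightarrow> ('n, 'q) cliff" where
  "X_minus_iP g x = X_cl g x - \<i> *s P_cl g x"

definition dom_X_minus_iP ::
  "('n rvec \<Rightarrow> ('n::{finite,linorder}, 'q::{finite,linorder}) cliff) set" where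
  "dom_X_minus_iP = {g. \<forall>k A. (\<lambda>x. g x $ A) \<in> dom_X k \<inter> dom_P k}"

end

theory Submission
  imports Defs "HOL-Probability.Characteristic_Functions" "HOL-Complex_Analysis.Cauchy_Integral_Formula"
begin

text \<open>
  Expanding \<open>e(\<cdot>, \<xi>)\<close> into its CK-series and integrating in \<open>\<xi>\<close> turns the kernel of the transform into
  the CK-extension of the Gaussian \<open>G(x - \<zeta>)\<close>, where \<open>G(s) = (2\<pi>)\<^bsup>-(p+1)/2\<^esup> exp(-\<bar>s\<bar>\<^sup>2/2)\<close>. Cauchy's estimates
  for the entire function \<open>exp(-z\<^sup>2/2)\<close> bound all derivatives of \<open>G\<close> well enough to interchange sums and
  integrals. Hence, for every square integrable \<open>h\<close>, the restriction of \<open>U[h]\<close> to \<open>y = 0\<close> is the real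
  analytic function \<open>G * h\<close>, and \<open>U[h]\<close> is its CK-extension. For \<open>h = (X - iP) g = \<zeta> g - D g\<close>, integration
  by parts gives \<open>G * h = x (G * g)\<close>, because \<open>D\<^sub>\<zeta>\<close> of \<open>G(x - \<zeta>)\<close> is \<open>(x - \<zeta>) G(x - \<zeta>)\<close>.
\<close>

section \<open>The Clifford product\<close>

text \<open>Two points shape the proof. The factors of the m-th power of y D_x do not commute in the
  algebra, whereas partial derivatives do. The m-th CK-term is therefore expanded over words
  \<open>ks\<close> of length m: the algebra part \<open>CKop y ks\<close> depends on the order of
  the letters, the derivative only on \<open>count_list ks\<close>. With n = p + 1 there are n^m
  words, each contributing at most B^m times a derivative of size m!/r^m. The factor 1/m! of the
  series cancels m!, and since the Gaussian is entire, the radius r in Cauchy's estimate is free; r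
  = 2nB leaves the geometric series of ratio 1/2 for every y. So U[h] is given by its CK-series on
  the whole space, not only near y = 0. Functions in the domain of X - iP have only weak
  derivatives, tested against smooth functions of compact support. The Gaussian is not such a
  function, so the integration by parts passes through products of the Gaussian with smooth cut-offs
  of growing support.\<close>

lemma norm_vector_scalar_mult: "norm (c *s v) = norm c * norm v"
  for c :: complex and v :: "complex ^ 'm"
  by (simp add: norm_vec_def norm_mult L2_set_right_distrib)

lemma bounded_bilinear_vector_scalar_mult:
  "bounded_bilinear ((*s) :: complex \<Rightarrow> complex ^ 'm \<Rightarrow> complex ^ 'm)"
  by (rule bounded_bilinear.intro; (rule exI[of _ 1])?)
    (auto simp: norm_vector_scalar_mult vec_eq_iff algebra_simps)

interpretation smult: bounded_bilinear "(*s) :: complex \<Rightarrow> complex ^ 'm \<Rightarrow> complex ^ 'm"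
  by (rule bounded_bilinear_vector_scalar_mult)

lemma cmult_scaleC_left: "(c *s l) \<odot> m = c *s (l \<odot> m)"
  by (simp add: cmult_def vec_eq_iff sum_distrib_left mult_ac)

lemma cmult_scaleC_right: "l \<odot> (c *s m) = c *s (l \<odot> m)"
  by (simp add: cmult_def vec_eq_iff sum_distrib_left mult_ac)

lemma scaleR_conv_smult: "r *\<^sub>R v = complex_of_real r *s v" for v :: "complex ^ 'm"
  by (simp add: vec_eq_iff scaleR_conv_of_real[where 'a = complex])

lemma bilinear_cmult: "bilinear cmult"
  unfolding bilinear_def
proof (intro conjI allI linearI)
  show "l \<odot> (m + n) = l \<odot> m + l \<odot> n" "(m + n) \<odot> l = m \<odot> l + n \<odot> l" for l m n :: "('a, 'b) cliff"
    by (simp_all add: cmult_def vec_eq_iff algebra_simps sum.distrib)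
  show "l \<odot> (r *\<^sub>R m) = r *\<^sub>R (l \<odot> m)" "(r *\<^sub>R m) \<odot> l = r *\<^sub>R (m \<odot> l)" for l m :: "('a, 'b) cliff" and r
    by (simp_all add: scaleR_conv_smult cmult_scaleC_left cmult_scaleC_right)
qed

interpretation cmult: bounded_bilinear cmult
  using bilinear_cmult by (simp add: bilinear_conv_bounded_bilinear)

text \<open>A pair with b < a costs a transposition and a pair with b = a a square, both with sign
  -1; hence the single condition b \<le> a. The product form makes the sign multiplicative in each
  argument.\<close>

lemma blade_sign_eq_prod: "blade_sign A B = (\<Prod>a\<in>A. \<Prod>b\<in>B. if b \<le> a then -1 else 1)"
proof -
  let ?lt = "{(a, b). a \<in> A \<and> b \<in> B \<and> b < a}"
  have le: "(A \<times> B) \<inter> {(a, b). b \<le> a} = ?lt \<union> (\<lambda>a. (a, a)) ` (A \<inter> B)" by auto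
  have "(\<Prod>a\<in>A. \<Prod>b\<in>B. if b \<le> a then -1 else 1 :: complex)
      = (\<Prod>z\<in>A \<times> B. if z \<in> {(a, b). b \<le> a} then -1 else 1)"
    by (simp add: prod.cartesian_product case_prod_unfold)
  also have "\<dots> = (-1) ^ card ((A \<times> B) \<inter> {(a, b). b \<le> a})"
    by (subst prod.If_cases) auto
  also have "card ((A \<times> B) \<inter> {(a, b). b \<le> a}) = card ?lt + card ((\<lambda>a. (a, a)) ` (A \<inter> B))"
    unfolding le by (rule card_Un_disjoint) auto
  also have "card ((\<lambda>a. (a, a)) ` (A \<inter> B)) = card (A \<inter> B)"
    by (rule card_image) (auto simp: inj_on_def)
  finally show ?thesis by (simp add: blade_sign_def)
qed

text \<open>The elements of A \<inter> B occur twice on the right and cancel because f takes values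
  with square 1.\<close>

lemma prod_symm_diff:
  fixes f :: "'a::finite \<Rightarrow> complex"
  assumes "\<And>a. f a * f a = 1"
  shows "prod f ((A - B) \<union> (B - A)) = prod f A * prod f B"
proof -
  have "prod f (A \<inter> B) * prod f (A \<inter> B) = 1"
    by (simp add: assms flip: prod.distrib)
  moreover have "prod f A = prod f (A - B) * prod f (A \<inter> B)"
    using prod.Int_Diff[of A f B] by (simp add: mult.commute)
  moreover have "prod f B = prod f (B - A) * prod f (A \<inter> B)"
    using prod.Int_Diff[of B f A] by (simp add: mult.commute Int_commute)
  moreover have "prod f ((A - B) \<union> (B - A)) = prod f (A - B) * prod f (B - A)"
    by (rule prod.union_disjoint) auto
  ultimately show ?thesis by (simp add: mult_ac)
qed

text \<open>Together with the next lemma: the sign is a bicharacter of the group of blade sets under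
  symmetric difference. This is what associativity rests on.\<close>

lemma blade_sign_symm_diff_left:
  "blade_sign ((A - B) \<union> (B - A)) C = blade_sign A C * blade_sign B C"
  unfolding blade_sign_eq_prod
  by (intro prod_symm_diff) (auto simp flip: prod.distrib intro!: prod.neutral)

lemma blade_sign_symm_diff_right:
  "blade_sign A ((B - C) \<union> (C - B)) = blade_sign A B * blade_sign A C"
  unfolding blade_sign_eq_prod by (subst prod_symm_diff) (simp_all add: prod.distrib)

lemma sum_blade: "(\<Sum>A\<in>UNIV. l $ A *s blade A) = l"
  unfolding blade_def by (rule basis_expansion)

text \<open>On blades both bracketings carry the sign of (A, B) times that of (A, C) times that of
  (B, C), and symmetric difference is associative. Bilinearity extends this to all elements.\<close>

lemma cmult_assoc: "(l \<odot> m) \<odot> n = l \<odot> (m \<odot> n)"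
proof -
  have blades: "(blade A \<odot> blade B) \<odot> blade C = blade A \<odot> (blade B \<odot> blade C)" for A B C
  proof -
    have "(A - B \<union> (B - A)) - C \<union> (C - (A - B \<union> (B - A))) = A - (B - C \<union> (C - B)) \<union> ((B - C \<union> (C - B)) - A)"
      by auto
    then show ?thesis
      by (simp add: blade_mult cmult_scaleC_left cmult_scaleC_right blade_sign_symm_diff_left
          blade_sign_symm_diff_right mult_ac)
  qed
  have "((\<Sum>A\<in>UNIV. l $ A *s blade A) \<odot> (\<Sum>B\<in>UNIV. m $ B *s blade B)) \<odot> (\<Sum>C\<in>UNIV. n $ C *s blade C)
      = (\<Sum>A\<in>UNIV. l $ A *s blade A) \<odot> ((\<Sum>B\<in>UNIV. m $ B *s blade B) \<odot> (\<Sum>C\<in>UNIV. n $ C *s blade C))"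
    by (simp only: cmult.sum_left cmult.sum_right cmult_scaleC_left cmult_scaleC_right blades)
  then show ?thesis by (simp only: sum_blade)
qed

lemma blade_empty_cmult: "blade {} \<odot> l = l"
proof -
  have blades: "blade {} \<odot> blade A = blade A" for A :: "('a, 'b) gen set"
    by (simp add: blade_mult blade_sign_def)
  have "blade {} \<odot> (\<Sum>A\<in>UNIV. l $ A *s blade A) = (\<Sum>A\<in>UNIV. l $ A *s blade A)"
    by (simp only: cmult.sum_right cmult_scaleC_right blades)
  then show ?thesis by (simp only: sum_blade)
qed

lemma scal_cmult: "scal c \<odot> l = c *s l"
  by (simp add: scal_def cmult_scaleC_left blade_empty_cmult)

section \<open>Powers of the operator in the CK-extension\<close>

text \<open>This is the algebra part of one summand of the expanded power of y D_x: left
  multiplication by y e_k for each letter k, the head of the list outermost.\<close>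

definition CKop :: "('q::{finite,linorder}) rvec \<Rightarrow> ('n::{finite,linorder}) list
    \<Rightarrow> ('n, 'q) cliff \<Rightarrow> ('n, 'q) cliff" where
  "CKop y = foldr (\<lambda>k v. yvec y \<odot> (e_x k \<odot> v))"

lemma CKop_simps [simp]:
  "CKop y [] v = v" "CKop y (k # ks) v = yvec y \<odot> (e_x k \<odot> CKop y ks v)"
  by (simp_all add: CKop_def)

lemma CKop_smult: "CKop y ks (c *s v) = c *s CKop y ks v"
  by (induction ks) (simp_all add: cmult_scaleC_right)

text \<open>By associativity left and right multiplications commute; this later moves h inside the
  words of the kernel.\<close>

lemma CKop_cmult: "CKop y ks v \<odot> w = CKop y ks (v \<odot> w)"
  by (induction ks) (simp_all add: cmult_assoc)

lemma bounded_linear_CKop: "bounded_linear (CKop y ks)"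
proof (induction ks)
  case Nil
  then show ?case by (simp add: bounded_linear_ident)
next
  case (Cons k ks)
  then show ?case
    by (simp add: bounded_linear_compose[OF cmult.bounded_linear_right]
        bounded_linear_compose[OF cmult.bounded_linear_right])
qed

lemma CKop_bound:
  fixes y :: "('q::{finite,linorder}) rvec"
  shows "\<exists>B\<ge>1. \<forall>ks (v :: ('n::{finite,linorder}, 'q) cliff). norm (CKop y ks v) \<le> B ^ length ks * norm v"
proof -
  define A where "A k v = yvec y \<odot> (e_x k \<odot> v)" for k :: 'n and v :: "('n, 'q) cliff"
  have "bounded_linear (A k)" for k
    unfolding A_def by (intro bounded_linear_compose[OF cmult.bounded_linear_right] cmult.bounded_linear_right)
  then have "\<exists>b. \<forall>v. norm (A k v) \<le> b * norm v" for k
    using bounded_linear.bounded[of "A k"] by (simp add: mult.commute)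
  then obtain b where b: "norm (A k v) \<le> b k * norm v" for k v by metis
  \<comment> \<open>The inserted 1 keeps B positive, as needed for monotonicity and for the Cauchy
    radius 2nB.\<close>
  define B where "B = Max (insert 1 (range b))"
  have B: "1 \<le> B" "b k \<le> B" for k unfolding B_def by (rule Max_ge; simp)+
  have AB: "norm (A k v) \<le> B * norm v" for k v
    using b[of k v] mult_right_mono[OF B(2)[of k] norm_ge_zero[of v]] by linarith
  have "norm (CKop y ks v) \<le> B ^ length ks * norm v" for ks :: "'n list" and v :: "('n, 'q) cliff"
  proof (induction ks)
    case (Cons k ks)
    have "norm (CKop y (k # ks) v) \<le> B * norm (CKop y ks v)"
      using AB[of k "CKop y ks v"] by (simp add: A_def)
    also have "\<dots> \<le> B * (B ^ length ks * norm v)"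
      using Cons B by (intro mult_left_mono) auto
    finally show ?case by (simp add: mult_ac)
  qed simp
  with B show ?thesis by blast
qed

abbreviation words :: "nat \<Rightarrow> 'n list set" where
  "words m \<equiv> {ks. length ks = m}"

lemma card_words: "card (words m :: 'n::finite list set) = CARD('n) ^ m"
  using card_lists_length_eq[of "UNIV :: 'n set" m] by simp

lemma words_Suc: "words (Suc m) = (\<lambda>(k, ks). k # ks) ` (UNIV \<times> words m)"
  by (auto simp: length_Suc_conv)

lemma count_list_Cons: "count_list (k # ks) = (count_list ks)(k := Suc (count_list ks k))"
  by auto

lemma ddir_eqI: "((\<lambda>t. F (x + t *\<^sub>R v)) has_vector_derivative d) (at 0) \<Longrightarrow> ddir v F x = d"
  unfolding ddir_def by (rule vector_derivative_at)

text \<open>U \<alpha> plays the role of the derivative of order \<alpha> of U 0. Indexing by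
  multi-indices builds in the symmetry of mixed derivatives. Applying the operator once more
  prepends a letter k to a word, which raises its count at k.\<close>

lemma funpow_CK_operator:
  fixes U :: "('n \<Rightarrow> nat) \<Rightarrow> 'n rvec \<Rightarrow> ('n::{finite,linorder}, 'q::{finite,linorder}) cliff"
  assumes "\<And>\<alpha> k x. ((\<lambda>t. U \<alpha> (x + t *\<^sub>R axis k 1)) has_vector_derivative
    U (\<alpha>(k := Suc (\<alpha> k))) x) (at 0)"
  shows "((\<lambda>F u. yvec y \<odot> D_x F u) ^^ m) (U (\<lambda>_. 0))
    = (\<lambda>x. \<Sum>ks\<in>words m. CKop y ks (U (count_list ks) x))"
proof (induction m)
  case 0
  show ?case by (simp add: count_list.simps(1)[abs_def])
next
  case (Suc m)
  show ?case
  proof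
    fix x
    let ?F = "\<lambda>x. \<Sum>ks\<in>words m. CKop y ks (U (count_list ks) x)"
    have "partial k ?F x = (\<Sum>ks\<in>words m. CKop y ks (U (count_list (k # ks)) x))" for k
      unfolding count_list_Cons
      by (intro ddir_eqI has_vector_derivative_sum
          bounded_linear.has_vector_derivative[OF bounded_linear_CKop] assms)
    then have "yvec y \<odot> D_x ?F x = (\<Sum>k\<in>UNIV. \<Sum>ks\<in>words m. CKop y (k # ks) (U (count_list (k # ks)) x))"
      by (simp add: D_x_def cmult.sum_right)
    also have "\<dots> = (\<Sum>ks\<in>words (Suc m). CKop y ks (U (count_list ks) x))"
      unfolding words_Suc
      by (subst sum.reindex) (auto simp: inj_on_def sum.cartesian_product case_prod_unfold)
    finally show "((\<lambda>F u. yvec y \<odot> D_x F u) ^^ Suc m) (U (\<lambda>_. 0)) x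
        = (\<Sum>ks\<in>words (Suc m). CKop y ks (U (count_list ks) x))"
      by (simp add: Suc)
  qed
qed

lemma CKop_zero: "ks \<noteq> [] \<Longrightarrow> CKop 0 ks v = 0"
  by (cases ks) (simp_all add: yvec_def cmult.zero_left)

section \<open>Integration\<close>

lemma has_vector_derivative_iff_quotient_tendsto:
  "(f has_vector_derivative D) (at 0) \<longleftrightarrow> ((\<lambda>h. (1 / h) *\<^sub>R (f h - f 0)) \<longlongrightarrow> D) (at 0)"
proof -
  have eq: "norm ((1 / norm (h - 0)) *\<^sub>R (f h - (f 0 + (h - 0) *\<^sub>R D))) = norm ((1 / h) *\<^sub>R (f h - f 0) - D)"
    if "h \<noteq> 0" for h
  proof -
    have "(1 / h) *\<^sub>R (f h - f 0) - D = (1 / h) *\<^sub>R (f h - (f 0 + h *\<^sub>R D))"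
      using that by (simp add: scaleR_diff_right scaleR_add_right)
    then show ?thesis by simp
  qed
  have "(f has_vector_derivative D) (at 0)
      \<longleftrightarrow> ((\<lambda>h. (1 / norm (h - 0)) *\<^sub>R (f h - (f 0 + (h - 0) *\<^sub>R D))) \<longlongrightarrow> 0) (at 0)"
    unfolding has_vector_derivative_def has_derivative_within by (simp add: bounded_linear_scaleR_left)
  also have "\<dots> \<longleftrightarrow> ((\<lambda>h. norm ((1 / norm (h - 0)) *\<^sub>R (f h - (f 0 + (h - 0) *\<^sub>R D)))) \<longlongrightarrow> 0) (at 0)"
    by (rule tendsto_norm_zero_iff[symmetric])
  also have "\<dots> \<longleftrightarrow> ((\<lambda>h. norm ((1 / h) *\<^sub>R (f h - f 0) - D)) \<longlongrightarrow> 0) (at 0)"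
    by (intro Lim_cong_within refl) (use eq in auto)
  also have "\<dots> \<longleftrightarrow> ((\<lambda>h. (1 / h) *\<^sub>R (f h - f 0)) \<longlongrightarrow> D) (at 0)"
    by (simp only: tendsto_norm_zero_iff LIM_zero_iff)
  finally show ?thesis .
qed

text \<open>The mean value inequality turns the bound on f' into a bound of the difference quotients
  by w, so dominated convergence applies along every sequence tending to 0.\<close>

lemma has_vector_derivative_integral:
  fixes f :: "real \<Rightarrow> 'a \<Rightarrow> 'b::{banach,second_countable_topology}"
  assumes f: "\<And>t. \<bar>t\<bar> \<le> 1 \<Longrightarrow> integrable M (f t)"
    and f': "f' 0 \<in> borel_measurable M"
    and deriv: "\<And>t z. \<bar>t\<bar> \<le> 1 \<Longrightarrow> ((\<lambda>t. f t z) has_vector_derivative f' t z) (at t)"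
    and bound: "\<And>t z. \<bar>t\<bar> \<le> 1 \<Longrightarrow> norm (f' t z) \<le> w z"
    and w: "integrable M w"
  shows "((\<lambda>t. \<integral>z. f t z \<partial>M) has_vector_derivative (\<integral>z. f' 0 z \<partial>M)) (at 0)"
proof -
  have int': "integrable M (f' 0)"
    by (rule Bochner_Integration.integrable_bound[OF w f']) (use bound[of 0] in \<open>auto intro: order_trans[OF _ abs_ge_self]\<close>)
  have lip: "norm (f t z - f 0 z) \<le> \<bar>t\<bar> * w z" if t: "\<bar>t\<bar> \<le> 1" for t z
  proof -
    have "norm (f t z - f 0 z) \<le> w z * norm (t - 0)"
    proof (rule differentiable_bound[where S = "cball 0 1"])
      fix s :: real assume "s \<in> cball 0 1"
      then have s: "\<bar>s\<bar> \<le> 1" by simp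
      from deriv[OF this, of z] show "((\<lambda>t. f t z) has_derivative (\<lambda>h. h *\<^sub>R f' s z)) (at s within cball 0 1)"
        by (simp add: has_vector_derivative_def has_derivative_at_withinI)
      show "onorm (\<lambda>h. h *\<^sub>R f' s z) \<le> w z"
        using bound[OF s, of z] by (intro onorm_le) (simp add: mult.commute mult_left_mono)
    qed (use t in auto)
    then show ?thesis by (simp add: mult.commute)
  qed
  have "((\<lambda>h. (1 / h) *\<^sub>R ((\<integral>z. f h z \<partial>M) - (\<integral>z. f 0 z \<partial>M))) \<longlongrightarrow> (\<integral>z. f' 0 z \<partial>M)) (at 0)"
    unfolding tendsto_at_iff_sequentially
  proof (intro allI impI)
    fix X :: "nat \<Rightarrow> real"
    assume X0: "\<forall>i. X i \<in> UNIV - {0}" and X: "X \<longlonglongrightarrow> 0"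
    from X have "eventually (\<lambda>i. \<bar>X i\<bar> < 1) sequentially"
      by (auto simp: tendsto_iff dist_real_def)
    \<comment> \<open>The bounds hold only for \<bar>t\<bar> \<le> 1; an initial segment of the
      sequence is dropped.\<close>
    then obtain N where N: "\<bar>X (i + N)\<bar> \<le> 1" for i
      unfolding eventually_sequentially by (metis le_add2 less_imp_le)
    let ?s = "\<lambda>i z. (1 / X (i + N)) *\<^sub>R (f (X (i + N)) z - f 0 z)"
    have "(\<lambda>i. \<integral>z. ?s i z \<partial>M) \<longlonglongrightarrow> (\<integral>z. f' 0 z \<partial>M)"
    proof (rule integral_dominated_convergence[where w = w])
      show "?s i \<in> borel_measurable M" for i
        using f[OF N[of i]] f[of 0] by auto
      show "AE z in M. (\<lambda>i. ?s i z) \<longlonglongrightarrow> f' 0 z"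
      proof (rule AE_I2)
        fix z
        have "((\<lambda>t. (1 / t) *\<^sub>R (f t z - f 0 z)) \<longlongrightarrow> f' 0 z) (at 0)"
          using deriv[of 0 z] by (simp add: has_vector_derivative_iff_quotient_tendsto)
        then have "((\<lambda>t. (1 / t) *\<^sub>R (f t z - f 0 z)) \<circ> (\<lambda>i. X (i + N))) \<longlonglongrightarrow> f' 0 z"
          by (rule tendsto_at_iff_sequentially[THEN iffD1, rule_format])
            (use X0 LIMSEQ_ignore_initial_segment[OF X] in auto)
        then show "(\<lambda>i. ?s i z) \<longlonglongrightarrow> f' 0 z" by (simp add: o_def)
      qed
      show "AE z in M. norm (?s i z) \<le> w z" for i
        using lip[OF N[of i]] X0 by (intro AE_I2) (auto simp: divide_simps mult.commute)
    qed (use f' w in auto)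
    also have "(\<lambda>i. \<integral>z. ?s i z \<partial>M)
        = (\<lambda>i. (1 / X (i + N)) *\<^sub>R ((\<integral>z. f (X (i + N)) z \<partial>M) - (\<integral>z. f 0 z \<partial>M)))"
      using f[OF N] f[of 0] by (simp add: Bochner_Integration.integral_diff)
    finally show "((\<lambda>h. (1 / h) *\<^sub>R ((\<integral>z. f h z \<partial>M) - (\<integral>z. f 0 z \<partial>M))) \<circ> X) \<longlonglongrightarrow> (\<integral>z. f' 0 z \<partial>M)"
      unfolding o_def by (rule LIMSEQ_offset)
  qed
  then show ?thesis
    by (simp add: has_vector_derivative_iff_quotient_tendsto)
qed

text \<open>The majorant separates the index from the variable, so summability of the norms and of
  their integrals both come from c.\<close>

lemma sums_integral_dominated:
  fixes f :: "nat \<Rightarrow> 'a \<Rightarrow> 'b::{banach,second_countable_topology}"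
  assumes f: "\<And>m. f m \<in> borel_measurable M"
    and bound: "\<And>m z. norm (f m z) \<le> c m * G z"
    and c: "summable c" and G: "integrable M G"
  shows "(\<lambda>m. \<integral>z. f m z \<partial>M) sums (\<integral>z. (\<Sum>m. f m z) \<partial>M)"
proof (rule sums_integral)
  show int: "integrable M (f m)" for m
    by (rule Bochner_Integration.integrable_bound[OF integrable_mult_right[OF G] f])
      (use bound[of m] in \<open>auto intro: order_trans[OF _ abs_ge_self]\<close>)
  show "AE z in M. summable (\<lambda>m. norm (f m z))"
  proof (rule AE_I2)
    show "summable (\<lambda>m. norm (f m z))" for z
      by (rule summable_comparison_test'[OF summable_mult2[OF c, of "G z"], of 0]) (simp add: bound)
  qed
  show "summable (\<lambda>m. \<integral>z. norm (f m z) \<partial>M)"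
  proof (rule summable_comparison_test'[OF summable_mult2[OF c, of "\<integral>z. G z \<partial>M"], of 0])
    fix m
    have "(\<integral>z. norm (f m z) \<partial>M) \<le> (\<integral>z. c m * G z \<partial>M)"
      by (intro integral_mono int integrable_norm integrable_mult_right G bound)
    then show "norm (\<integral>z. norm (f m z) \<partial>M) \<le> c m * (\<integral>z. G z \<partial>M)"
      by simp
  qed
qed

text \<open>Fubini for products of one-variable functions: Lebesgue measure is the image of a
  product measure indexed by \<open>Basis\<close>, and \<open>ix\<close> translates basis vectors
  back into coordinates.\<close>

lemma lborel_prod_vec:
  fixes f :: "'n::finite \<Rightarrow> real \<Rightarrow> 'b::{real_normed_field,banach,second_countable_topology}"
  assumes "\<And>k. integrable lborel (f k)"
  shows "integrable lborel (\<lambda>x :: (real, 'n) vec. \<Prod>k\<in>UNIV. f k (x $ k))"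
    and "(\<integral>x. (\<Prod>k\<in>UNIV. f k (x $ k)) \<partial>(lborel :: (real, 'n) vec measure)) = (\<Prod>k\<in>UNIV. \<integral>t. f k t \<partial>lborel)"
proof -
  interpret product_sigma_finite "\<lambda>_ :: (real, 'n) vec. lborel :: real measure" ..
  define ix where "ix b = (THE k. b = (axis k 1 :: (real, 'n) vec))" for b
  have ix: "ix (axis k 1) = k" for k by (auto simp: ix_def axis_eq_axis)
  have B: "(Basis :: (real, 'n) vec set) = range (\<lambda>k. axis k 1)" by (auto simp: Basis_vec_def)
  have inj: "inj (\<lambda>k :: 'n. axis k (1 :: real))" by (auto simp: inj_on_def axis_eq_axis)
  have pr: "(\<Prod>k\<in>UNIV. f k ((\<Sum>b\<in>Basis. x b *\<^sub>R b) $ k)) = (\<Prod>b\<in>Basis. f (ix b) (x b))"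
    for x :: "(real, 'n) vec \<Rightarrow> real"
  proof -
    have "(\<Sum>j\<in>UNIV. x (axis j 1) *\<^sub>R axis j (1 :: real)) $ k = x (axis k 1)" for k
      unfolding sum_component vector_scaleR_component
      by (subst sum.remove[of _ k]) (auto simp: axis_def intro!: sum.neutral)
    then show ?thesis
      unfolding B prod.reindex[OF inj] sum.reindex[OF inj] by (simp add: ix)
  qed
  have m: "(\<lambda>x. \<Sum>b\<in>Basis. x b *\<^sub>R b) \<in> measurable (\<Pi>\<^sub>M b\<in>Basis. lborel) (borel :: (real, 'n) vec measure)"
    by measurable
  have fm: "f k \<in> borel_measurable borel" for k using assms[of k] by auto
  have mf: "(\<lambda>x :: (real, 'n) vec. \<Prod>k\<in>UNIV. f k (x $ k)) \<in> borel_measurable borel"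
    by (intro borel_measurable_prod measurable_compose[OF _ fm])
      (auto intro!: borel_measurable_continuous_onI continuous_intros)
  show "integrable lborel (\<lambda>x :: (real, 'n) vec. \<Prod>k\<in>UNIV. f k (x $ k))"
    unfolding lborel_eq[where 'a = "(real, 'n) vec"] integrable_distr_eq[OF m mf] pr
    using assms by (intro product_integrable_prod) auto
  show "(\<integral>x. (\<Prod>k\<in>UNIV. f k (x $ k)) \<partial>(lborel :: (real, 'n) vec measure)) = (\<Prod>k\<in>UNIV. \<integral>t. f k t \<partial>lborel)"
    unfolding lborel_eq[where 'a = "(real, 'n) vec"] integral_distr[OF m mf] pr
    using assms by (subst product_integral_prod) (auto simp: B prod.reindex[OF inj] ix)
qed

section \<open>Derivatives of the Gaussian\<close>

text \<open>On the real line this is the m-th derivative of exp(-s^2/2), a Hermite polynomial times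
  the Gaussian up to sign. It is defined through the entire extension so that Cauchy's inequality
  and the power series apply directly.\<close>

definition gauss_deriv :: "nat \<Rightarrow> real \<Rightarrow> complex" where
  "gauss_deriv m s = (deriv ^^ m) (\<lambda>z. exp (- z\<^sup>2 / 2)) (of_real s)"

lemma holomorphic_gauss: "(\<lambda>z :: complex. exp (- z\<^sup>2 / 2)) holomorphic_on S"
  by (auto intro!: holomorphic_intros)

lemma gauss_deriv_0: "gauss_deriv 0 s = of_real (exp (- s\<^sup>2 / 2))"
  by (simp add: gauss_deriv_def flip: exp_of_real)

lemma has_vector_derivative_gauss_deriv:
  "(gauss_deriv m has_vector_derivative gauss_deriv (Suc m) s) (at s)"
proof -
  have "(deriv ^^ m) (\<lambda>z :: complex. exp (- z\<^sup>2 / 2)) holomorphic_on UNIV"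
    by (intro holomorphic_higher_deriv holomorphic_gauss) auto
  then have "((deriv ^^ m) (\<lambda>z. exp (- z\<^sup>2 / 2)) has_field_derivative gauss_deriv (Suc m) s) (at (of_real s))"
    by (simp add: gauss_deriv_def holomorphic_derivI)
  from has_vector_derivative_real_field[OF this] show ?thesis
    by (simp add: gauss_deriv_def[abs_def])
qed

text \<open>Cauchy's inequality on the circle of radius r about s, where the real part of -z^2/2 is
  at most r^2 - s^2/4. The Gaussian decay in s survives, and r stays free for the later
  series.\<close>

lemma norm_gauss_deriv_le:
  assumes r: "0 < r"
  shows "norm (gauss_deriv m s) \<le> fact m * (exp (r\<^sup>2) * exp (- s\<^sup>2 / 4)) / r ^ m"
  unfolding gauss_deriv_def
proof (rule Cauchy_inequality[OF holomorphic_gauss _ r])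
  show "continuous_on (cball (of_real s) r) (\<lambda>z :: complex. exp (- z\<^sup>2 / 2))"
    by (intro continuous_intros) auto
  fix z :: complex assume z: "norm (of_real s - z) = r"
  have Re: "\<bar>Re z - s\<bar> \<le> r" and Im: "\<bar>Im z\<bar> \<le> r"
    using abs_Re_le_cmod[of "of_real s - z"] abs_Im_le_cmod[of "of_real s - z"] z by auto
  have "(Im z)\<^sup>2 \<le> r\<^sup>2" using power_mono[OF Im, of 2] by simp
  moreover have "(Re z - s)\<^sup>2 \<le> r\<^sup>2" using power_mono[OF Re, of 2] by simp
  \<comment> \<open>The difference of the two sides is the square of 2 Re z - s.\<close>
  moreover have "s\<^sup>2 \<le> 2 * (Re z)\<^sup>2 + 2 * (Re z - s)\<^sup>2"
  proof -
    have "0 \<le> (2 * Re z - s)\<^sup>2" by simp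
    then show ?thesis by (simp add: power2_eq_square algebra_simps)
  qed
  ultimately have "- (((Re z)\<^sup>2 - (Im z)\<^sup>2) / 2) \<le> r\<^sup>2 - s\<^sup>2 / 4"
    unfolding minus_divide_left by (simp add: field_simps)
  then show "norm (exp (- z\<^sup>2 / 2)) \<le> exp (r\<^sup>2) * exp (- s\<^sup>2 / 4)"
    by (simp add: norm_exp_eq_Re Re_power2 flip: exp_add)
qed

text \<open>The function is entire, so any disc about s containing s + t will do.\<close>

lemma gauss_deriv_sums:
  "(\<lambda>m. gauss_deriv m s / fact m * of_real t ^ m) sums gauss_deriv 0 (s + t)"
  using holomorphic_power_series[OF holomorphic_gauss, of "of_real (s + t)" "of_real s" "\<bar>t\<bar> + 1"]
  by (simp add: gauss_deriv_def dist_norm algebra_simps)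

lemma integrable_exp_square: "0 < c \<Longrightarrow> integrable lborel (\<lambda>t :: real. exp (- c * (a - t)\<^sup>2))"
proof -
  assume c: "0 < c"
  \<comment> \<open>Chosen so that c = 1/(2\<sigma>^2), which makes the integrand a multiple of a
    normal density.\<close>
  define \<sigma> where "\<sigma> = 1 / sqrt (2 * c)"
  have \<sigma>: "\<sigma> > 0" "\<sigma>\<^sup>2 = 1 / (2 * c)" using c by (simp_all add: \<sigma>_def power_divide)
  have "integrable lborel (\<lambda>t. sqrt (2 * pi * \<sigma>\<^sup>2) * normal_density a \<sigma> t)"
    by (intro integrable_mult_right integrable_normal_density \<sigma>)
  also have "(\<lambda>t. sqrt (2 * pi * \<sigma>\<^sup>2) * normal_density a \<sigma> t) = (\<lambda>t. exp (- c * (a - t)\<^sup>2))"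
    using c \<sigma> by (simp add: normal_density_def fun_eq_iff power2_commute mult.commute)
  finally show ?thesis .
qed

lemma integrable_gauss_moment:
  "integrable lborel (\<lambda>t :: real. exp (- t\<^sup>2 / 2) * \<bar>t\<bar> ^ m)"
proof -
  have "integrable lborel (\<lambda>t. sqrt (2 * pi) * (std_normal_density t * \<bar>t - 0\<bar> ^ m))"
    by (intro integrable_mult_right integrable_normal_moment_abs) simp
  then show ?thesis by (simp add: std_normal_density_def)
qed

text \<open>For m = 0 this is the characteristic function of the standard normal distribution.
  Differentiating both sides in s brings down one factor i\<xi> on the left and raises m on the
  right.\<close>

lemma gauss_deriv_Fourier:
  "integrable lborel (\<lambda>\<xi>. of_real (exp (- \<xi>\<^sup>2 / 2)) * (\<i> * of_real \<xi>) ^ m * exp (\<i> * of_real (s * \<xi>)))" (is ?I)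
  "(\<integral>\<xi>. of_real (exp (- \<xi>\<^sup>2 / 2)) * (\<i> * of_real \<xi>) ^ m * exp (\<i> * of_real (s * \<xi>)) \<partial>lborel)
    = of_real (sqrt (2 * pi)) * gauss_deriv m s"
proof -
  let ?f = "\<lambda>m s \<xi>. of_real (exp (- \<xi>\<^sup>2 / 2)) * (\<i> * of_real \<xi>) ^ m * exp (\<i> * of_real (s * \<xi>)) :: complex"
  have meas [measurable]: "?f m s \<in> borel_measurable borel" for m s
    by (auto intro!: borel_measurable_continuous_onI continuous_intros)
  have norm: "norm (?f m s \<xi>) = exp (- \<xi>\<^sup>2 / 2) * \<bar>\<xi>\<bar> ^ m" for m s \<xi>
    by (simp add: norm_mult norm_power del: of_real_mult)
  have int: "integrable lborel (?f m s)" for m s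
    by (rule Bochner_Integration.integrable_bound[OF integrable_gauss_moment[of m]])
      (simp_all only: norm meas measurable_lborel2, simp)
  then show ?I .
  show "(\<integral>\<xi>. ?f m s \<xi> \<partial>lborel) = of_real (sqrt (2 * pi)) * gauss_deriv m s"
  proof (induction m arbitrary: s)
    case 0
    have "(\<integral>\<xi>. std_normal_density \<xi> *\<^sub>R exp (\<i> * of_real (s * \<xi>)) \<partial>lborel) = char std_normal_distribution s"
      unfolding char_def by (subst integral_density) auto
    also have "\<dots> = gauss_deriv 0 s"
      by (simp add: char_std_normal_distribution gauss_deriv_0)
    finally have *: "(\<integral>\<xi>. std_normal_density \<xi> *\<^sub>R exp (\<i> * of_real (s * \<xi>)) \<partial>lborel) = gauss_deriv 0 s" .
    have "?f 0 s = (\<lambda>\<xi>. of_real (sqrt (2 * pi)) * (std_normal_density \<xi> *\<^sub>R exp (\<i> * of_real (s * \<xi>))))"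
      by (simp add: std_normal_density_def fun_eq_iff scaleR_conv_of_real)
    then show ?case by (simp only: integral_mult_right_zero *)
  next
    case (Suc m)
    have "((\<lambda>t. \<integral>\<xi>. ?f m (s + t) \<xi> \<partial>lborel) has_vector_derivative (\<integral>\<xi>. ?f (Suc m) (s + 0) \<xi> \<partial>lborel)) (at 0)"
    proof (rule has_vector_derivative_integral[OF _ _ _ _ integrable_gauss_moment[of "Suc m"]])
      fix t \<xi> :: real
      have "((\<lambda>z. of_real (exp (- \<xi>\<^sup>2 / 2)) * (\<i> * of_real \<xi>) ^ m * exp (\<i> * (of_real s + z) * of_real \<xi>)) has_field_derivative
          ?f (Suc m) (s + t) \<xi>) (at (of_real t))"
        by (auto intro!: derivative_eq_intros simp: mult_ac)
      from has_vector_derivative_real_field[OF this]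
      show "((\<lambda>t. ?f m (s + t) \<xi>) has_vector_derivative ?f (Suc m) (s + t) \<xi>) (at t)"
        by (simp add: mult_ac)
      show "norm (?f (Suc m) (s + t) \<xi>) \<le> exp (- \<xi>\<^sup>2 / 2) * \<bar>\<xi>\<bar> ^ Suc m"
        by (simp only: norm)
      show "integrable lborel (?f m (s + t))" by (rule int)
      show "?f (Suc m) (s + 0) \<in> borel_measurable lborel"
        using meas by (simp only: measurable_lborel2)
    qed
    moreover have "((\<lambda>t. \<integral>\<xi>. ?f m (s + t) \<xi> \<partial>lborel) has_vector_derivative of_real (sqrt (2 * pi)) * gauss_deriv (Suc m) s) (at 0)"
    proof -
      have "((gauss_deriv m \<circ> (\<lambda>t. s + t)) has_vector_derivative 1 *\<^sub>R gauss_deriv (Suc m) s) (at 0)"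
        by (rule vector_diff_chain_at) (auto intro!: derivative_eq_intros has_vector_derivative_gauss_deriv)
      then show ?thesis
        unfolding Suc by (intro has_vector_derivative_mult_right) (simp add: o_def)
    qed
    ultimately show ?case by (auto dest: vector_derivative_unique_at)
  qed
qed

text \<open>Only the factor with index k depends on t. The family d is abstract because the Gaussian
  and its cut-off versions both use it.\<close>

lemma partial_prod:
  fixes d :: "'n::finite \<Rightarrow> nat \<Rightarrow> real \<Rightarrow> 'b::real_normed_field"
  assumes "\<And>k m t. (d k m has_vector_derivative d k (Suc m) t) (at t)"
  shows "((\<lambda>t. \<Prod>j\<in>UNIV. d j (\<alpha> j) ((x + t *\<^sub>R axis k 1) $ j)) has_vector_derivative
    (\<Prod>j\<in>UNIV. d j ((\<alpha>(k := Suc (\<alpha> k))) j) ((x + s *\<^sub>R axis k 1) $ j))) (at s)"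
proof -
  let ?R = "\<Prod>j\<in>UNIV - {k}. d j (\<alpha> j) (x $ j)"
  have split: "(\<Prod>j\<in>UNIV. d j (\<beta> j) ((x + t *\<^sub>R axis k 1) $ j)) = d k (\<beta> k) (x $ k + t) * (\<Prod>j\<in>UNIV - {k}. d j (\<beta> j) (x $ j))"
    for \<beta> t
    by (subst prod.remove[of _ k]) (auto simp: axis_def intro!: prod.cong)
  have "((d k (\<alpha> k) \<circ> (\<lambda>t. x $ k + t)) has_vector_derivative 1 *\<^sub>R d k (Suc (\<alpha> k)) (x $ k + s)) (at s)"
    by (rule vector_diff_chain_at) (auto intro!: derivative_eq_intros assms)
  then have "((\<lambda>t. d k (\<alpha> k) (x $ k + t) * ?R) has_vector_derivative d k (Suc (\<alpha> k)) (x $ k + s) * ?R) (at s)"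
    by (intro has_vector_derivative_mult_left) (simp add: o_def)
  also have "?R = (\<Prod>j\<in>UNIV - {k}. d j ((\<alpha>(k := Suc (\<alpha> k))) j) (x $ j))"
    by (intro prod.cong) auto
  finally show ?thesis
    unfolding split by (simp cong: prod.cong_simp)
qed

section \<open>The Gaussian in several variables, as a product over the coordinates\<close>

lemma exp_norm_square_vec: "exp (c * (norm s)\<^sup>2) = (\<Prod>k\<in>UNIV. exp (c * (s $ k)\<^sup>2))"
  for s :: "'n::finite rvec"
  by (simp add: norm_vec_def L2_set_def sum_nonneg sum_distrib_left exp_sum)

text \<open>Derivatives of exp(-\<bar>s\<bar>^2/2) without the normalising factor of G; that factor
  enters as \<kappa> in \<open>SB_sums\<close>.\<close>

definition gaussn_deriv :: "('n::finite \<Rightarrow> nat) \<Rightarrow> 'n rvec \<Rightarrow> complex" where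
  "gaussn_deriv \<alpha> s = (\<Prod>k\<in>UNIV. gauss_deriv (\<alpha> k) (s $ k))"

lemma gaussn_deriv_0: "gaussn_deriv (\<lambda>_. 0) s = of_real (exp (- (norm s)\<^sup>2 / 2))"
  using exp_norm_square_vec[of "- 1 / 2" s] by (simp add: gaussn_deriv_def gauss_deriv_0 flip: of_real_prod)

lemma has_vector_derivative_gaussn_deriv:
  "((\<lambda>t. gaussn_deriv \<alpha> (x + t *\<^sub>R axis k 1)) has_vector_derivative
    gaussn_deriv (\<alpha>(k := Suc (\<alpha> k))) (x + s *\<^sub>R axis k 1)) (at s)"
  unfolding gaussn_deriv_def
  by (rule partial_prod[where d = "\<lambda>_. gauss_deriv"]) (rule has_vector_derivative_gauss_deriv)

lemma continuous_gaussn_deriv: "continuous_on UNIV (gaussn_deriv \<alpha>)"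
proof -
  have "continuous_on UNIV (gauss_deriv m)" for m
    by (intro continuous_at_imp_continuous_on ballI)
      (rule has_vector_derivative_continuous[OF has_vector_derivative_gauss_deriv])
  then have "continuous_on UNIV (\<lambda>s. gauss_deriv (\<alpha> k) (s $ k))" for k
    by (rule continuous_on_compose2) (auto intro!: continuous_intros)
  then show ?thesis
    unfolding gaussn_deriv_def[abs_def] by (rule continuous_on_prod)
qed

lemma borel_measurable_gaussn_deriv [measurable]: "gaussn_deriv \<alpha> \<in> borel_measurable borel"
  by (rule borel_measurable_continuous_onI[OF continuous_gaussn_deriv])

lemma norm_gaussn_deriv_le:
  fixes s :: "'n::finite rvec"
  assumes r: "0 < r"
  shows "norm (gaussn_deriv \<alpha> s)
    \<le> exp (real CARD('n) * r\<^sup>2) * (\<Prod>k\<in>UNIV. fact (\<alpha> k) / r ^ \<alpha> k) * exp (- (norm s)\<^sup>2 / 4)"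
proof -
  have "norm (gaussn_deriv \<alpha> s) \<le> (\<Prod>k\<in>UNIV. fact (\<alpha> k) * (exp (r\<^sup>2) * exp (- (s $ k)\<^sup>2 / 4)) / r ^ \<alpha> k)"
    unfolding gaussn_deriv_def prod_norm[symmetric] using norm_gauss_deriv_le[OF r]
    by (intro prod_mono) simp
  also have "\<dots> = exp (real CARD('n) * r\<^sup>2) * (\<Prod>k\<in>UNIV. fact (\<alpha> k) / r ^ \<alpha> k) * (\<Prod>k\<in>UNIV. exp (- (s $ k)\<^sup>2 / 4))"
    by (simp add: prod.distrib prod_dividef exp_of_nat_mult)
  also have "(\<Prod>k\<in>UNIV. exp (- (s $ k)\<^sup>2 / 4)) = exp (- (norm s)\<^sup>2 / 4)"
    using exp_norm_square_vec[of "- 1 / 4" s] by simp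
  finally show ?thesis .
qed

lemma gaussn_deriv_Fourier:
  fixes s :: "'n::finite rvec" and \<alpha> :: "'n \<Rightarrow> nat"
  defines "F \<equiv> \<lambda>\<xi>. of_real (exp (- (norm \<xi>)\<^sup>2 / 2)) * (\<Prod>k\<in>UNIV. (\<i> * of_real (\<xi> $ k)) ^ \<alpha> k) * exp (\<i> * of_real (s \<bullet> \<xi>))"
  shows "integrable lborel F"
    and "integral\<^sup>L lborel F = of_real (sqrt (2 * pi) ^ CARD('n)) * gaussn_deriv \<alpha> s"
proof -
  have F: "F = (\<lambda>\<xi>. \<Prod>k\<in>UNIV. of_real (exp (- (\<xi> $ k)\<^sup>2 / 2)) * (\<i> * of_real (\<xi> $ k)) ^ \<alpha> k * exp (\<i> * of_real (s $ k * \<xi> $ k)))"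
  proof
    fix \<xi> :: "'n rvec"
    have "of_real (exp (- (norm \<xi>)\<^sup>2 / 2)) = (\<Prod>k\<in>UNIV. of_real (exp (- (\<xi> $ k)\<^sup>2 / 2)) :: complex)"
      using exp_norm_square_vec[of "- 1 / 2" \<xi>] by (simp flip: of_real_prod)
    moreover have "exp (\<i> * of_real (s \<bullet> \<xi>)) = (\<Prod>k\<in>UNIV. exp (\<i> * of_real (s $ k * \<xi> $ k)))"
      by (simp add: inner_vec_def sum_distrib_left exp_sum)
    ultimately show "F \<xi> = (\<Prod>k\<in>UNIV. of_real (exp (- (\<xi> $ k)\<^sup>2 / 2)) * (\<i> * of_real (\<xi> $ k)) ^ \<alpha> k * exp (\<i> * of_real (s $ k * \<xi> $ k)))"
      unfolding F_def by (simp only: prod.distrib)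
  qed
  show "integrable lborel F"
    unfolding F by (rule lborel_prod_vec(1)[OF gauss_deriv_Fourier(1)])
  show "integral\<^sup>L lborel F = of_real (sqrt (2 * pi) ^ CARD('n)) * gaussn_deriv \<alpha> s"
    unfolding F lborel_prod_vec(2)[OF gauss_deriv_Fourier(1)] gauss_deriv_Fourier(2)
    by (simp add: gaussn_deriv_def prod.distrib)
qed

lemma integrable_exp_square_vec:
  fixes x :: "'n::finite rvec"
  assumes c: "0 < c"
  shows "integrable lborel (\<lambda>z. exp (- c * (norm (x - z))\<^sup>2))"
proof -
  have "(\<lambda>z. exp (- c * (norm (x - z))\<^sup>2)) = (\<lambda>z. \<Prod>k\<in>UNIV. exp (- c * (x $ k - z $ k)\<^sup>2))"
    using exp_norm_square_vec[of "- c" "x - z" for z] by simp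
  then show ?thesis
    using lborel_prod_vec(1)[of "\<lambda>k t. exp (- c * (x $ k - t)\<^sup>2)"] integrable_exp_square[OF c] by simp
qed

text \<open>The quotient of the right side by the left is a multinomial coefficient. The bound
  replaces \<alpha>! by m!, which the factor 1/m! of a CK-term cancels.\<close>

lemma prod_fact_count_list_le: "(\<Prod>k\<in>UNIV. fact (count_list ks k)) \<le> (fact (length ks) :: real)"
  for ks :: "'n::finite list"
proof (induction ks)
  case (Cons k ks)
  have "(\<Prod>j\<in>UNIV. fact (count_list (k # ks) j) :: real)
      = of_nat (Suc (count_list ks k)) * (\<Prod>j\<in>UNIV. fact (count_list ks j))"
    by (subst (1 2) prod.remove[of _ k]) (auto simp: algebra_simps intro!: prod.cong)
  also have "\<dots> \<le> of_nat (Suc (length ks)) * fact (length ks)"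
    by (intro mult_mono Cons) (auto simp: count_le_length intro: prod_nonneg)
  finally show ?case by simp
qed simp

lemma prod_power_count_list: "(\<Prod>k\<in>UNIV. r ^ count_list ks k) = r ^ length ks"
  for r :: "'a::comm_semiring_1" and ks :: "'n::finite list"
  using sum_count_set[of ks UNIV] by (simp flip: power_sum)

lemma norm_gaussn_deriv_count_list_le:
  fixes s :: "'n::finite rvec"
  assumes r: "0 < r"
  shows "norm (gaussn_deriv (count_list ks) s)
    \<le> exp (real CARD('n) * r\<^sup>2) * (fact (length ks) / r ^ length ks) * exp (- (norm s)\<^sup>2 / 4)"
proof -
  have "norm (gaussn_deriv (count_list ks) s)
    \<le> exp (real CARD('n) * r\<^sup>2) * ((\<Prod>k\<in>UNIV. fact (count_list ks k)) / r ^ length ks) * exp (- (norm s)\<^sup>2 / 4)"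
    using norm_gaussn_deriv_le[OF r, of "count_list ks" s] by (simp add: prod_dividef prod_power_count_list)
  also have "\<dots> \<le> exp (real CARD('n) * r\<^sup>2) * (fact (length ks) / r ^ length ks) * exp (- (norm s)\<^sup>2 / 4)"
    using r by (intro mult_right_mono mult_left_mono divide_right_mono prod_fact_count_list_le) auto
  finally show ?thesis .
qed

section \<open>Square integrable functions with values in the Clifford algebra\<close>

lemma borel_measurable_vec:
  fixes h :: "'a \<Rightarrow> complex ^ 'm"
  assumes "\<And>A. (\<lambda>x. h x $ A) \<in> borel_measurable M"
  shows "h \<in> borel_measurable M"
proof -
  have "(\<lambda>x. \<Sum>A\<in>UNIV. h x $ A *s axis A 1) \<in> borel_measurable M"
    by (intro borel_measurable_sum measurable_compose[OF assms]
        borel_measurable_continuous_onI linear_continuous_on smult.bounded_linear_left)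
  then show ?thesis by (simp add: basis_expansion)
qed

text \<open>The norm of the algebra is Euclidean in the blade coefficients, so its square is the sum
  of their squared moduli. Closure under bounded linear maps is easier in this form.\<close>

lemma L2C_iff: "h \<in> L2C M \<longleftrightarrow> h \<in> borel_measurable M \<and> integrable M (\<lambda>x. (norm (h x))\<^sup>2)"
proof (intro iffI conjI)
  assume h: "h \<in> L2C M"
  then show "h \<in> borel_measurable M"
    by (intro borel_measurable_vec) (simp add: L2C_def L2_def)
  have "(norm (h x))\<^sup>2 = (\<Sum>A\<in>UNIV. (norm (h x $ A))\<^sup>2)" for x
    by (simp add: norm_vec_def L2_set_def sum_nonneg)
  then show "integrable M (\<lambda>x. (norm (h x))\<^sup>2)"
    using h by (simp add: L2C_def L2_def)
next
  assume h: "h \<in> borel_measurable M \<and> integrable M (\<lambda>x. (norm (h x))\<^sup>2)"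
  have m: "(\<lambda>x. h x $ A) \<in> borel_measurable M" for A
    using h by (intro measurable_compose[of h M borel "\<lambda>v. v $ A"])
      (auto intro!: borel_measurable_continuous_onI continuous_intros)
  have "integrable M (\<lambda>x. (norm (h x $ A))\<^sup>2)" for A
    by (rule Bochner_Integration.integrable_bound[of M "\<lambda>x. (norm (h x))\<^sup>2"])
      (use h m in \<open>auto intro!: power_mono Finite_Cartesian_Product.norm_nth_le\<close>)
  with m show "h \<in> L2C M" by (simp add: L2C_def L2_def)
qed

lemma L2C_add: "h1 \<in> L2C M \<Longrightarrow> h2 \<in> L2C M \<Longrightarrow> (\<lambda>x. h1 x + h2 x) \<in> L2C M"
proof -
  assume h: "h1 \<in> L2C M" "h2 \<in> L2C M"
  have bd: "(norm (h1 x + h2 x))\<^sup>2 \<le> 2 * (norm (h1 x))\<^sup>2 + 2 * (norm (h2 x))\<^sup>2" for x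
  proof -
    have "(norm (h1 x + h2 x))\<^sup>2 \<le> (norm (h1 x) + norm (h2 x))\<^sup>2"
      by (intro power_mono norm_triangle_ineq) auto
    also have "\<dots> \<le> 2 * (norm (h1 x))\<^sup>2 + 2 * (norm (h2 x))\<^sup>2"
      using sum_squares_bound[of "norm (h1 x)" "norm (h2 x)"] by (simp add: power2_sum)
    finally show ?thesis .
  qed
  have "integrable M (\<lambda>x. (norm (h1 x + h2 x))\<^sup>2)"
    by (rule Bochner_Integration.integrable_bound[of M "\<lambda>x. 2 * (norm (h1 x))\<^sup>2 + 2 * (norm (h2 x))\<^sup>2"])
      (use h bd in \<open>auto simp: L2C_iff\<close>)
  then show ?thesis using h by (auto simp: L2C_iff intro: borel_measurable_add)
qed

lemma L2C_bounded_linear: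
  assumes T: "bounded_linear T" and h: "h \<in> L2C M"
  shows "(\<lambda>x. T (h x)) \<in> L2C M"
proof -
  obtain K where K: "\<And>v. norm (T v) \<le> norm v * K" using bounded_linear.bounded[OF T] by blast
  have m: "(\<lambda>x. T (h x)) \<in> borel_measurable M"
    using h by (intro measurable_compose[of h M borel T])
      (auto simp: L2C_iff intro!: borel_measurable_continuous_onI linear_continuous_on T)
  have "integrable M (\<lambda>x. (norm (T (h x)))\<^sup>2)"
  proof (rule Bochner_Integration.integrable_bound)
    show "integrable M (\<lambda>x. K\<^sup>2 * (norm (h x))\<^sup>2)"
      using h by (simp add: L2C_iff)
    show "AE x in M. norm ((norm (T (h x)))\<^sup>2) \<le> norm (K\<^sup>2 * (norm (h x))\<^sup>2)"
      using K by (intro AE_I2) (auto simp: power_mult_distrib[symmetric] mult.commute intro!: power_mono)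
  qed (use m in measurable)
  with m show ?thesis by (simp add: L2C_iff)
qed

lemma L2C_zero: "(\<lambda>x. 0) \<in> L2C M"
  by (simp add: L2C_iff)

lemma L2C_sum: "(\<And>i. i \<in> I \<Longrightarrow> h i \<in> L2C M) \<Longrightarrow> (\<lambda>x. \<Sum>i\<in>I. h i x) \<in> L2C M"
  by (induction I rule: infinite_finite_induct) (auto simp: L2C_zero L2C_add)

text \<open>From ab \<le> a^2 + b^2 with a the Gaussian, whose square is a Gaussian with constant
  2c. This supplies all majorants that involve a square integrable function.\<close>

lemma integrable_gauss_square_integrable:
  fixes x :: "'n::finite rvec" and h :: "'n rvec \<Rightarrow> 'b::{real_normed_vector,second_countable_topology}"
  assumes h1: "h \<in> borel_measurable lborel" and h2: "integrable lborel (\<lambda>z. (norm (h z))\<^sup>2)" and c: "0 < c"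
  shows "integrable lborel (\<lambda>z. exp (- c * (norm (x - z))\<^sup>2) * norm (h z))"
proof (rule Bochner_Integration.integrable_bound)
  show "integrable lborel (\<lambda>z. exp (- (2 * c) * (norm (x - z))\<^sup>2) + (norm (h z))\<^sup>2)"
    using h2 c by (intro Bochner_Integration.integrable_add integrable_exp_square_vec) auto
  show "(\<lambda>z. exp (- c * (norm (x - z))\<^sup>2) * norm (h z)) \<in> borel_measurable lborel"
  proof -
    have [measurable]: "h \<in> borel_measurable borel" using h1 by simp
    show ?thesis by measurable
  qed
  have "a * b \<le> a\<^sup>2 + b\<^sup>2" if "0 \<le> a" "0 \<le> b" for a b :: real
  proof -
    have "a * b \<le> 2 * a * b" using that by simp
    then show ?thesis using sum_squares_bound[of a b] by linarith
  qed
  from this[of "exp (- c * (norm (x - z))\<^sup>2)" "norm (h z)" for z]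
  have "exp (- c * (norm (x - z))\<^sup>2) * norm (h z) \<le> exp (- (2 * c) * (norm (x - z))\<^sup>2) + (norm (h z))\<^sup>2" for z
    by (simp add: mult.assoc flip: exp_double)
  then show "AE z in lborel. norm (exp (- c * (norm (x - z))\<^sup>2) * norm (h z))
      \<le> norm (exp (- (2 * c) * (norm (x - z))\<^sup>2) + (norm (h z))\<^sup>2)"
    by (intro AE_I2) (auto simp: abs_of_nonneg)
qed

lemma integrable_gauss_L2C:
  fixes x :: "'n::{finite,linorder} rvec" and h :: "'n rvec \<Rightarrow> ('n, 'q::{finite,linorder}) cliff"
  assumes "h \<in> L2C lborel" and "0 < c"
  shows "integrable lborel (\<lambda>z. exp (- c * (norm (x - z))\<^sup>2) * norm (h z))"
  using assms by (intro integrable_gauss_square_integrable) (auto simp: L2C_iff)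

section \<open>Convolution with derivatives of the Gaussian\<close>

lemma gaussn_deriv_bound: "\<exists>C\<ge>0. \<forall>s. norm (gaussn_deriv \<alpha> s) \<le> C * exp (- (1 / 4) * (norm s)\<^sup>2)"
  using norm_gaussn_deriv_le[of 1 \<alpha>]
  by (intro exI[of _ "exp (real CARD('a) * 1\<^sup>2) * (\<Prod>k\<in>UNIV. fact (\<alpha> k) / 1 ^ \<alpha> k)"])
    (auto intro!: mult_nonneg_nonneg prod_nonneg)

text \<open>All derivatives fall on the Gaussian, since h is merely square integrable.\<close>

definition gauss_conv :: "('n \<Rightarrow> nat) \<Rightarrow> ('n::{finite,linorder} rvec \<Rightarrow> ('n, 'q::{finite,linorder}) cliff)
    \<Rightarrow> 'n rvec \<Rightarrow> ('n, 'q) cliff" where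
  "gauss_conv \<alpha> h x = (\<integral>z. gaussn_deriv \<alpha> (x - z) *s h z \<partial>lborel)"

lemma borel_measurable_gauss_conv_integrand:
  fixes h :: "'n rvec \<Rightarrow> ('n::{finite,linorder}, 'q::{finite,linorder}) cliff"
  assumes "h \<in> L2C lborel"
  shows "(\<lambda>z. gaussn_deriv \<alpha> (x - z) *s h z) \<in> borel_measurable lborel"
proof (rule borel_measurable_continuous_Pair[where H = "(*s)"])
  show "h \<in> borel_measurable lborel" using assms by (simp add: L2C_iff)
  show "continuous_on UNIV (\<lambda>z :: complex \<times> ('n, 'q) cliff. fst z *s snd z)"
    by (intro smult.continuous_on continuous_intros)
qed simp

lemma integrable_gauss_conv:
  fixes h :: "'n rvec \<Rightarrow> ('n::{finite,linorder}, 'q::{finite,linorder}) cliff"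
  assumes h: "h \<in> L2C lborel"
  shows "integrable lborel (\<lambda>z. gaussn_deriv \<alpha> (x - z) *s h z)"
proof -
  obtain C where C: "0 \<le> C" "\<And>s. norm (gaussn_deriv \<alpha> s) \<le> C * exp (- (1 / 4) * (norm s)\<^sup>2)"
    using gaussn_deriv_bound[of \<alpha>] by blast
  show ?thesis
  proof (rule Bochner_Integration.integrable_bound[OF _ borel_measurable_gauss_conv_integrand[OF h]])
    show "integrable lborel (\<lambda>z. C * (exp (- (1 / 4) * (norm (x - z))\<^sup>2) * norm (h z)))"
      by (intro integrable_mult_right integrable_gauss_L2C h) simp
    show "AE z in lborel. norm (gaussn_deriv \<alpha> (x - z) *s h z)
        \<le> norm (C * (exp (- (1 / 4) * (norm (x - z))\<^sup>2) * norm (h z)))"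
      using C mult_right_mono[OF C(2) norm_ge_zero]
      by (intro AE_I2) (simp add: norm_vector_scalar_mult abs_of_nonneg mult.assoc)
  qed
qed

lemma has_vector_derivative_gauss_conv:
  assumes h: "h \<in> L2C lborel"
  shows "((\<lambda>t. gauss_conv \<alpha> h (x + t *\<^sub>R axis k 1)) has_vector_derivative
    gauss_conv (\<alpha>(k := Suc (\<alpha> k))) h x) (at 0)"
proof -
  let ?\<beta> = "\<alpha>(k := Suc (\<alpha> k))"
  obtain C where C: "0 \<le> C" "\<And>s. norm (gaussn_deriv ?\<beta> s) \<le> C * exp (- (1 / 4) * (norm s)\<^sup>2)"
    using gaussn_deriv_bound[of ?\<beta>] by blast
  \<comment> \<open>The majorant must serve all shifts by at most 1: \<bar>x - z\<bar>^2 \<le>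
    2\<bar>s\<bar>^2 + 2 for the shifted argument s halves the rate 1/4 to 1/8 and costs the factor
    exp(1/4).\<close>
  let ?w = "\<lambda>z. (C * exp (1 / 4)) * (exp (- (1 / 8) * (norm (x - z))\<^sup>2) * norm (h z))"
  have "((\<lambda>t. \<integral>z. gaussn_deriv \<alpha> ((x - z) + t *\<^sub>R axis k 1) *s h z \<partial>lborel) has_vector_derivative
      (\<integral>z. gaussn_deriv ?\<beta> ((x - z) + 0 *\<^sub>R axis k 1) *s h z \<partial>lborel)) (at 0)"
  proof (rule has_vector_derivative_integral[where w = ?w])
    show "integrable lborel (\<lambda>z. gaussn_deriv \<alpha> ((x - z) + t *\<^sub>R axis k 1) *s h z)" for t
      using integrable_gauss_conv[OF h, of \<alpha> "x + t *\<^sub>R axis k 1"] by (simp add: algebra_simps)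
    show "(\<lambda>z. gaussn_deriv ?\<beta> ((x - z) + 0 *\<^sub>R axis k 1) *s h z) \<in> borel_measurable lborel"
      using borel_measurable_gauss_conv_integrand[OF h, of ?\<beta> x] by simp
    show "((\<lambda>t. gaussn_deriv \<alpha> ((x - z) + t *\<^sub>R axis k 1) *s h z) has_vector_derivative
        gaussn_deriv ?\<beta> ((x - z) + t *\<^sub>R axis k 1) *s h z) (at t)" for t z
      by (intro bounded_linear.has_vector_derivative[OF smult.bounded_linear_left]
          has_vector_derivative_gaussn_deriv)
    show "integrable lborel ?w"
      by (intro integrable_mult_right integrable_gauss_L2C h) simp
    fix t :: real and z assume t: "\<bar>t\<bar> \<le> 1"
    let ?s = "(x - z) + t *\<^sub>R axis k 1"
    have "(norm (x - z))\<^sup>2 \<le> (norm ?s + 1)\<^sup>2"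
      using t norm_triangle_ineq4[of ?s "t *\<^sub>R axis k 1"] by (intro power_mono) auto
    also have "\<dots> \<le> 2 * (norm ?s)\<^sup>2 + 2"
      using sum_squares_bound[of "norm ?s" 1] by (simp add: power2_sum)
    finally have "- (1 / 4) * (norm ?s)\<^sup>2 \<le> 1 / 4 + - (1 / 8) * (norm (x - z))\<^sup>2" by simp
    then have "exp (- (1 / 4) * (norm ?s)\<^sup>2) \<le> exp (1 / 4) * exp (- (1 / 8) * (norm (x - z))\<^sup>2)"
      by (simp only: exp_add[symmetric] exp_le_cancel_iff)
    then have "norm (gaussn_deriv ?\<beta> ?s) \<le> C * (exp (1 / 4) * exp (- (1 / 8) * (norm (x - z))\<^sup>2))"
      using C(2)[of ?s] mult_left_mono[OF _ C(1)] order_trans by blast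
    from mult_right_mono[OF this norm_ge_zero[of "h z"]]
    show "norm (gaussn_deriv ?\<beta> ?s *s h z) \<le> ?w z"
      by (simp only: norm_vector_scalar_mult mult.assoc)
  qed
  then show ?thesis by (simp add: gauss_conv_def algebra_simps)
qed

section \<open>The Segal-Bargmann transform as a CK-extension\<close>

lemma CK_term_family:
  fixes U :: "('n \<Rightarrow> nat) \<Rightarrow> 'n rvec \<Rightarrow> ('n::{finite,linorder}, 'q::{finite,linorder}) cliff"
  assumes "\<And>\<alpha> k x. ((\<lambda>t. U \<alpha> (x + t *\<^sub>R axis k 1)) has_vector_derivative
    U (\<alpha>(k := Suc (\<alpha> k))) x) (at 0)"
  shows "CK_term (U (\<lambda>_. 0)) (x, y) m
    = (1 / fact m) *\<^sub>R (\<Sum>ks\<in>words m. CKop y ks (U (count_list ks) x))"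
  by (simp add: CK_term_def funpow_CK_operator[of U, OF assms])

lemma norm_sum_words_le:
  fixes T :: "'n::finite list \<Rightarrow> 'b::real_normed_vector"
  assumes "\<And>ks. length ks = m \<Longrightarrow> norm (T ks) \<le> b"
  shows "norm (\<Sum>ks\<in>words m. T ks) \<le> real CARD('n) ^ m * b"
  using sum_norm_bound[of "words m" T b] assms by (simp add: card_words)

lemma power_div_fact_le_exp: "0 \<le> a \<Longrightarrow> a ^ m / fact m \<le> exp a" for a :: real
proof -
  assume a: "0 \<le> a"
  have "(\<Sum>k\<in>{m}. a ^ k /\<^sub>R fact k) \<le> (\<Sum>k. a ^ k /\<^sub>R fact k)"
    using a by (intro sum_le_suminf summable_exp_generic) auto
  then show ?thesis by (simp add: exp_def divide_inverse mult.commute)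
qed

text \<open>Each derivative of the plane wave multiplies it by some i\<xi>_k, so scalars separate
  from the words, which act on 1 only.\<close>

lemma CK_term_wave:
  fixes x \<xi> :: "'n::{finite,linorder} rvec" and y :: "'q::{finite,linorder} rvec"
  shows "CK_term (\<lambda>x. scal (exp (\<i> * complex_of_real (x \<bullet> \<xi>)))) (x, y) m
    = (1 / fact m) *\<^sub>R (\<Sum>ks\<in>words m. ((\<Prod>k\<in>UNIV. (\<i> * of_real (\<xi> $ k)) ^ count_list ks k)
        * exp (\<i> * complex_of_real (x \<bullet> \<xi>))) *s CKop y ks (scal 1 :: ('n, 'q) cliff))"
proof -
  define U where "U \<alpha> x = ((\<Prod>k\<in>UNIV. (\<i> * of_real (\<xi> $ k)) ^ \<alpha> k) * exp (\<i> * complex_of_real (x \<bullet> \<xi>)))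
      *s (scal 1 :: ('n, 'q) cliff)" for \<alpha> and x :: "'n rvec"
  have U: "((\<lambda>t. U \<alpha> (x + t *\<^sub>R axis k 1)) has_vector_derivative U (\<alpha>(k := Suc (\<alpha> k))) x) (at 0)" for \<alpha> k x
  proof -
    let ?P = "\<Prod>j\<in>UNIV. (\<i> * of_real (\<xi> $ j)) ^ \<alpha> j :: complex"
    have P: "(\<Prod>j\<in>UNIV. (\<i> * of_real (\<xi> $ j)) ^ (\<alpha>(k := Suc (\<alpha> k))) j :: complex) = (\<i> * of_real (\<xi> $ k)) * ?P"
      by (subst (1 2) prod.remove[of _ k]) (auto intro!: prod.cong)
    have "((\<lambda>t. ?P * exp (\<i> * (of_real (x \<bullet> \<xi>) + t * of_real (\<xi> $ k)))) has_field_derivative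
        (\<i> * of_real (\<xi> $ k)) * ?P * exp (\<i> * of_real (x \<bullet> \<xi>))) (at (of_real 0))"
      by (auto intro!: derivative_eq_intros)
    from has_vector_derivative_real_field[OF this]
    have "((\<lambda>t. ?P * exp (\<i> * of_real ((x + t *\<^sub>R axis k 1) \<bullet> \<xi>))) has_vector_derivative
        (\<i> * of_real (\<xi> $ k)) * ?P * exp (\<i> * of_real (x \<bullet> \<xi>))) (at 0)"
      by (simp add: inner_add_left inner_axis')
    then show ?thesis
      unfolding U_def P by (rule bounded_linear.has_vector_derivative[OF smult.bounded_linear_left])
  qed
  have "(\<lambda>x. scal (exp (\<i> * complex_of_real (x \<bullet> \<xi>)))) = U (\<lambda>_. 0)"
    by (simp add: U_def scal_def fun_eq_iff)
  then show ?thesis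
    using CK_term_family[of U x y m, OF U] by (simp add: U_def CKop_smult)
qed

lemma norm_wave_word:
  "norm (\<Prod>k\<in>UNIV. (\<i> * complex_of_real (\<xi> $ k)) ^ count_list ks k) \<le> norm \<xi> ^ length ks"
  for \<xi> :: "'n::finite rvec"
proof -
  have "norm (\<Prod>k\<in>UNIV. (\<i> * complex_of_real (\<xi> $ k)) ^ count_list ks k)
      = (\<Prod>k\<in>UNIV. \<bar>\<xi> $ k\<bar> ^ count_list ks k)"
    by (simp add: norm_power norm_mult flip: prod_norm)
  also have "\<dots> \<le> (\<Prod>k\<in>UNIV. norm \<xi> ^ count_list ks k)"
    by (intro prod_mono conjI power_mono component_le_norm_cart) auto
  finally show ?thesis by (simp add: prod_power_count_list)
qed

text \<open>The phases of x and \<zeta> combine to a plane wave in x - \<zeta>. Integrating term by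
  term, each word yields a derivative of the Gaussian at x - \<zeta> by Fourier inversion of the
  polynomial factor.\<close>

lemma kernel_sums:
  fixes x \<zeta> :: "'n::{finite,linorder} rvec" and y :: "'q::{finite,linorder} rvec"
  shows "(\<lambda>m. (1 / fact m) *\<^sub>R (\<Sum>ks\<in>words m. (of_real (sqrt (2 * pi) ^ CARD('n)) *
      gaussn_deriv (count_list ks) (x - \<zeta>)) *s CKop y ks (scal 1 :: ('n, 'q) cliff))) sums
    (\<integral>\<xi>. (complex_of_real (exp (- (norm \<xi>)\<^sup>2 / 2)) * exp (- \<i> * complex_of_real (\<zeta> \<bullet> \<xi>))) *s e_fun (x, y) \<xi> \<partial>lborel)"
proof -
  obtain B where B: "1 \<le> B" "\<And>ks (v :: ('n, 'q) cliff). norm (CKop y ks v) \<le> B ^ length ks * norm v"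
    using CKop_bound[of y] by blast
  define n where "n = real CARD('n)"
  define K where "K = norm (scal 1 :: ('n, 'q) cliff)"
  define F where "F \<alpha> \<xi> = of_real (exp (- (norm \<xi>)\<^sup>2 / 2)) * (\<Prod>k\<in>UNIV. (\<i> * of_real (\<xi> $ k)) ^ \<alpha> k)
      * exp (\<i> * of_real ((x - \<zeta>) \<bullet> \<xi>))" for \<alpha> and \<xi> :: "'n rvec"
  define f where "f m \<xi> = (1 / fact m) *\<^sub>R (\<Sum>ks\<in>words m. F (count_list ks) \<xi> *s CKop y ks (scal 1 :: ('n, 'q) cliff))" for m \<xi>
  note Fourier = gaussn_deriv_Fourier[where s = "x - \<zeta>", folded F_def]
  have n: "0 \<le> n" by (simp add: n_def)
  have intF: "integrable lborel (\<lambda>\<xi>. F \<alpha> \<xi> *s v)" for \<alpha> and v :: "('n, 'q) cliff"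
    by (rule integrable_bounded_linear[OF smult.bounded_linear_left Fourier(1)])
  have f_int: "integral\<^sup>L lborel (f m) = (1 / fact m) *\<^sub>R (\<Sum>ks\<in>words m. (of_real (sqrt (2 * pi) ^ CARD('n)) *
      gaussn_deriv (count_list ks) (x - \<zeta>)) *s CKop y ks (scal 1 :: ('n, 'q) cliff))" for m
    unfolding f_def
    by (simp add: integral_sum intF integral_bounded_linear[OF smult.bounded_linear_left Fourier(1)] Fourier(2))
  have bound: "norm (f m \<xi>) \<le> (1 / 2) ^ m * (K * exp (4 * (n * B)\<^sup>2) * exp (- (1 / 4) * (norm (0 - \<xi>))\<^sup>2))" for m \<xi>
  proof -
    have "norm (F (count_list ks) \<xi> *s CKop y ks (scal 1 :: ('n, 'q) cliff))
        \<le> (exp (- (norm \<xi>)\<^sup>2 / 2) * norm \<xi> ^ m) * (B ^ m * K)" if "length ks = m" for ks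
      unfolding norm_vector_scalar_mult K_def
    proof (intro mult_mono)
      show "norm (F (count_list ks) \<xi>) \<le> exp (- (norm \<xi>)\<^sup>2 / 2) * norm \<xi> ^ m"
        using norm_wave_word[of \<xi> ks] that by (simp add: F_def norm_mult)
    qed (use B(2)[of ks "scal 1"] that in auto)
    then have "norm (f m \<xi>) \<le> (1 / fact m) * (n ^ m * ((exp (- (norm \<xi>)\<^sup>2 / 2) * norm \<xi> ^ m) * (B ^ m * K)))"
      unfolding f_def norm_scaleR n_def by (intro mult_mono norm_sum_words_le) auto
    \<comment> \<open>A factor 2^m is moved into the power: what remains is one term of an
      exponential series, and the summable factor (1/2)^m is left over.\<close>
    also have "\<dots> = (1 / 2) ^ m * (K * exp (- (norm \<xi>)\<^sup>2 / 2) * ((2 * n * B * norm \<xi>) ^ m / fact m))"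
      by (simp add: power_mult_distrib power_one_over field_simps)
    also have "\<dots> \<le> (1 / 2) ^ m * (K * exp (- (norm \<xi>)\<^sup>2 / 2) * exp (2 * n * B * norm \<xi>))"
      using B n by (intro mult_left_mono power_div_fact_le_exp) (auto simp: K_def)
    also have "\<dots> = (1 / 2) ^ m * (K * exp (- (norm \<xi>)\<^sup>2 / 2 + 2 * n * B * norm \<xi>))"
      by (simp only: exp_add mult.assoc)
    also have "\<dots> \<le> (1 / 2) ^ m * (K * exp (4 * (n * B)\<^sup>2 + - (1 / 4) * (norm (0 - \<xi>))\<^sup>2))"
    proof (intro mult_left_mono iffD2[OF exp_le_cancel_iff])
      \<comment> \<open>Completing the square: a quarter of \<bar>\<xi>\<bar>^2 absorbs the linear
        term.\<close>
      have "0 \<le> (norm \<xi> / 2 - 2 * (n * B))\<^sup>2" by simp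
      then show "- (norm \<xi>)\<^sup>2 / 2 + 2 * n * B * norm \<xi> \<le> 4 * (n * B)\<^sup>2 + - (1 / 4) * (norm (0 - \<xi>))\<^sup>2"
        by (simp add: power2_diff power_mult_distrib power_divide algebra_simps)
    qed (auto simp: K_def)
    also have "\<dots> = (1 / 2) ^ m * (K * exp (4 * (n * B)\<^sup>2) * exp (- (1 / 4) * (norm (0 - \<xi>))\<^sup>2))"
      by (simp only: exp_add mult.assoc)
    finally show ?thesis .
  qed
  have "(\<lambda>m. integral\<^sup>L lborel (f m)) sums (\<integral>\<xi>. (\<Sum>m. f m \<xi>) \<partial>lborel)"
  proof (rule sums_integral_dominated[OF _ bound])
    show "f m \<in> borel_measurable lborel" for m
      unfolding f_def
      by (intro borel_measurable_scaleR borel_measurable_const borel_measurable_sum borel_measurable_integrable intF)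
    show "integrable lborel (\<lambda>\<xi>. K * exp (4 * (n * B)\<^sup>2) * exp (- (1 / 4) * (norm (0 - \<xi> :: 'n rvec))\<^sup>2))"
      by (intro integrable_mult_right integrable_exp_square_vec) simp
  qed (simp add: summable_geometric)
  moreover have "(\<Sum>m. f m \<xi>) = (complex_of_real (exp (- (norm \<xi>)\<^sup>2 / 2)) * exp (- \<i> * complex_of_real (\<zeta> \<bullet> \<xi>))) *s e_fun (x, y) \<xi>" for \<xi>
  proof -
    let ?w = "complex_of_real (exp (- (norm \<xi>)\<^sup>2 / 2)) * exp (- \<i> * complex_of_real (\<zeta> \<bullet> \<xi>))"
    define e where "e m = CK_term (\<lambda>x. scal (exp (\<i> * complex_of_real (x \<bullet> \<xi>)))) (x, y) m" for m
    \<comment> \<open>Both directions are used: the inverse weight carries summability from f to the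
      CK-terms, and only then may the weight be moved through the \<open>suminf\<close> in
      \<open>e_fun\<close>.\<close>
    have e: "e m = inverse ?w *s f m \<xi>" "f m \<xi> = ?w *s e m" for m
    proof -
      have "F \<alpha> \<xi> = ?w * ((\<Prod>k\<in>UNIV. (\<i> * of_real (\<xi> $ k)) ^ \<alpha> k) * exp (\<i> * complex_of_real (x \<bullet> \<xi>)))" for \<alpha>
        by (simp add: F_def inner_diff_left right_diff_distrib exp_diff exp_minus field_simps)
      then show fe: "f m \<xi> = ?w *s e m"
        by (simp add: f_def e_def CK_term_wave smult.scaleR_right smult.sum_right)
      have w: "?w \<noteq> 0" by simp
      show "e m = inverse ?w *s f m \<xi>"
        by (simp only: fe vector_smult_assoc left_inverse[OF w] vector_smult_lid)
    qed
    have "summable (\<lambda>m. (1 / 2) ^ m * (K * exp (4 * (n * B)\<^sup>2) * exp (- (1 / 4) * (norm (0 - \<xi>))\<^sup>2)))"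
      by (intro summable_mult2 summable_geometric) simp
    then have "summable (\<lambda>m. f m \<xi>)"
      by (rule summable_comparison_test'[where N = 0]) (rule bound)
    then have "summable e"
      unfolding e(1) by (rule bounded_linear.summable[OF smult.bounded_linear_right])
    then show ?thesis
      unfolding e(2) e_fun_def CK_def e_def[symmetric]
      by (rule bounded_linear.suminf[OF smult.bounded_linear_right, symmetric])
  qed
  ultimately show ?thesis
    by (simp only: f_int)
qed

text \<open>The second interchange, now with the integral over \<zeta>. The constant \<kappa> is
  (2\<pi>)^(-n/2) for n = \<open>CARD('n)\<close>: the Fourier integral contributes the numerator,
  the transform the denominator.\<close>

theorem SB_sums:
  fixes h :: "'n::{finite,linorder} rvec \<Rightarrow> ('n, 'q::{finite,linorder}) cliff"
  assumes h: "h \<in> L2C lborel"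
  defines "\<kappa> \<equiv> sqrt (2 * pi) ^ CARD('n) / (2 * pi) ^ CARD('n)"
  shows "(\<lambda>m. (1 / fact m) *\<^sub>R (\<Sum>ks\<in>words m. CKop y ks (\<kappa> *\<^sub>R gauss_conv (count_list ks) h x))) sums SB h (x, y)"
proof -
  obtain B where B: "1 \<le> B" "\<And>ks (v :: ('n, 'q) cliff). norm (CKop y ks v) \<le> B ^ length ks * norm v"
    using CKop_bound[of y] by blast
  define n where "n = real CARD('n)"
  \<comment> \<open>With this Cauchy radius, n^m words and the operator bound B^m against r^m leave
    (1/2)^m.\<close>
  define r where "r = 2 * n * B"
  define c where "c = sqrt (2 * pi) ^ CARD('n)"
  have n: "1 \<le> n" by (simp add: n_def Suc_leI)
  have r: "0 < r" using n B by (simp add: r_def)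
  have c: "0 \<le> c" by (simp add: c_def)
  define f where "f m \<zeta> = (1 / fact m) *\<^sub>R (\<Sum>ks\<in>words m. c *\<^sub>R CKop y ks (gaussn_deriv (count_list ks) (x - \<zeta>) *s h \<zeta>))" for m \<zeta>
  define I where "I \<zeta> = (\<integral>\<xi>. (complex_of_real (exp (- (norm \<xi>)\<^sup>2 / 2)) * exp (- \<i> * complex_of_real (\<zeta> \<bullet> \<xi>)))
            *s (e_fun (x, y) \<xi> :: ('n, 'q) cliff) \<partial>lborel)" for \<zeta> :: "'n rvec"
  have int: "integrable lborel (\<lambda>\<zeta>. CKop y ks (gaussn_deriv \<alpha> (x - \<zeta>) *s h \<zeta>))" for ks \<alpha>
    by (rule integrable_bounded_linear[OF bounded_linear_CKop integrable_gauss_conv[OF h]])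
  have I: "I \<zeta> \<odot> h \<zeta> = (\<Sum>m. f m \<zeta>)" for \<zeta>
  proof (rule sums_unique)
    have "(c *\<^sub>R CKop y ks (gaussn_deriv \<alpha> (x - \<zeta>) *s h \<zeta>)) = ((of_real c * gaussn_deriv \<alpha> (x - \<zeta>)) *s CKop y ks (scal 1)) \<odot> h \<zeta>" for ks \<alpha>
      by (simp add: cmult_scaleC_left CKop_cmult scal_cmult CKop_smult scaleR_conv_smult)
    then show "(\<lambda>m. f m \<zeta>) sums (I \<zeta> \<odot> h \<zeta>)"
      using bounded_linear.sums[OF cmult.bounded_linear_left kernel_sums[of x \<zeta> y]]
      by (simp add: f_def I_def c_def cmult.scaleR_left cmult.sum_left)
  qed
  have SB: "SB h (x, y) = (1 / (2 * pi) ^ CARD('n)) *\<^sub>R (\<integral>\<zeta>. (\<Sum>m. f m \<zeta>) \<partial>lborel)"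
    by (simp only: SB_def I[symmetric] I_def)
  have "(\<lambda>m. integral\<^sup>L lborel (f m)) sums (\<integral>\<zeta>. (\<Sum>m. f m \<zeta>) \<partial>lborel)"
  proof (rule sums_integral_dominated)
    show "f m \<in> borel_measurable lborel" for m
      unfolding f_def
      by (intro borel_measurable_scaleR borel_measurable_const borel_measurable_sum borel_measurable_integrable int)
    show "integrable lborel (\<lambda>\<zeta>. c * exp (n * r\<^sup>2) * (exp (- (1 / 4) * (norm (x - \<zeta>))\<^sup>2) * norm (h \<zeta>)))"
      by (intro integrable_mult_right integrable_gauss_L2C h) simp
    show "summable (\<lambda>m. (1 / 2 :: real) ^ m)" by (simp add: summable_geometric)
    fix m \<zeta>
    have "norm (c *\<^sub>R CKop y ks (gaussn_deriv (count_list ks) (x - \<zeta>) *s h \<zeta>))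
        \<le> c * (B ^ m * ((exp (n * r\<^sup>2) * (fact m / r ^ m) * exp (- (norm (x - \<zeta>))\<^sup>2 / 4)) * norm (h \<zeta>)))"
      if "length ks = m" for ks
    proof -
      have "norm (CKop y ks (gaussn_deriv (count_list ks) (x - \<zeta>) *s h \<zeta>))
          \<le> B ^ m * (norm (gaussn_deriv (count_list ks) (x - \<zeta>)) * norm (h \<zeta>))"
        using B(2)[of ks "gaussn_deriv (count_list ks) (x - \<zeta>) *s h \<zeta>"] that
        by (simp add: norm_vector_scalar_mult)
      also have "\<dots> \<le> B ^ m * ((exp (n * r\<^sup>2) * (fact m / r ^ m) * exp (- (norm (x - \<zeta>))\<^sup>2 / 4)) * norm (h \<zeta>))"
        using B(1) norm_gaussn_deriv_count_list_le[OF r, of ks "x - \<zeta>"] that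
        by (intro mult_left_mono mult_right_mono) (auto simp: n_def)
      finally show ?thesis
        using mult_left_mono[OF _ c] by (simp only: norm_scaleR abs_of_nonneg[OF c])
    qed
    then have "norm (f m \<zeta>) \<le> (1 / fact m) * (n ^ m * (c * (B ^ m * ((exp (n * r\<^sup>2) * (fact m / r ^ m) * exp (- (norm (x - \<zeta>))\<^sup>2 / 4)) * norm (h \<zeta>)))))"
      unfolding f_def norm_scaleR[of "1 / fact m"] n_def by (intro mult_mono norm_sum_words_le) auto
    also have "\<dots> = (1 / 2) ^ m * (c * exp (n * r\<^sup>2) * (exp (- (1 / 4) * (norm (x - \<zeta>))\<^sup>2) * norm (h \<zeta>)))"
      using n B by (simp add: r_def power_mult_distrib field_simps)
    finally show "norm (f m \<zeta>) \<le> (1 / 2) ^ m * (c * exp (n * r\<^sup>2) * (exp (- (1 / 4) * (norm (x - \<zeta>))\<^sup>2) * norm (h \<zeta>)))" .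
  qed
  from sums_scaleR_right[OF this, of "1 / (2 * pi) ^ CARD('n)"]
  show ?thesis
    unfolding SB f_def
    by (simp add: integral_sum int integral_bounded_linear[OF bounded_linear_CKop integrable_gauss_conv[OF h]]
        linear_scale[OF bounded_linear.linear[OF bounded_linear_CKop]] gauss_conv_def scaleR_sum_right \<kappa>_def c_def mult_ac)
qed

text \<open>At y = 0 every nonempty word vanishes, so only the term m = 0 remains.\<close>

corollary SB_restriction:
  fixes h :: "'n::{finite,linorder} rvec \<Rightarrow> ('n, 'q::{finite,linorder}) cliff"
  assumes h: "h \<in> L2C lborel"
  shows "SB h (x, 0) = (sqrt (2 * pi) ^ CARD('n) / (2 * pi) ^ CARD('n)) *\<^sub>R gauss_conv (\<lambda>_. 0) h x"
proof -
  let ?t = "\<lambda>m. (1 / fact m) *\<^sub>R (\<Sum>ks\<in>words m. CKop 0 ks ((sqrt (2 * pi) ^ CARD('n) / (2 * pi) ^ CARD('n)) *\<^sub>R gauss_conv (count_list ks) h x))"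
  have "?t m = 0" if "m \<notin> {0}" for m
    using that by (intro scaleR_eq_0_iff[THEN iffD2] disjI2 sum.neutral) (auto intro!: CKop_zero)
  then have "?t sums (\<Sum>m\<in>{0}. ?t m)" by (intro sums_finite) auto
  with SB_sums[OF h, of 0 x] have "SB h (x, 0) = (\<Sum>m\<in>{0}. ?t m)" by (rule sums_unique2)
  then show ?thesis by (simp add: count_list.simps(1)[abs_def])
qed

text \<open>The multiples \<kappa> of \<open>gauss_conv \<alpha> h\<close> are the derivatives of
  the restriction, so the series of \<open>SB_sums\<close> is its CK-series. Using
  \<open>sums\<close> records convergence, which \<open>CK\<close> alone would not.\<close>

corollary SB_CK:
  fixes h :: "'n::{finite,linorder} rvec \<Rightarrow> ('n, 'q::{finite,linorder}) cliff"
  assumes h: "h \<in> L2C lborel"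
  shows "CK_term (\<lambda>x. SB h (x, 0)) z sums SB h z"
proof (cases z)
  case (Pair x y)
  let ?U = "\<lambda>\<alpha> x. (sqrt (2 * pi) ^ CARD('n) / (2 * pi) ^ CARD('n)) *\<^sub>R gauss_conv \<alpha> h x"
  have "CK_term (?U (\<lambda>_. 0)) (x, y) = (\<lambda>m. (1 / fact m) *\<^sub>R (\<Sum>ks\<in>words m. CKop y ks (?U (count_list ks) x)))"
    by (rule ext, rule CK_term_family[of ?U])
      (intro bounded_linear.has_vector_derivative[OF bounded_linear_scaleR_right] has_vector_derivative_gauss_conv h)
  then show ?thesis
    using SB_sums[OF h, of y x] by (simp only: SB_restriction[OF h] Pair)
qed

section \<open>Real analyticity\<close>

lemma summable_on_geometric_multi:
  "(\<lambda>\<alpha> :: 'n::finite \<Rightarrow> nat. \<Prod>k\<in>UNIV. (1 / 2 :: real) ^ \<alpha> k) summable_on UNIV"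
proof -
  have geo: "(\<lambda>m. norm ((1 / 2 :: real) ^ m)) summable_on UNIV"
    by (simp add: summable_on_UNIV_nonneg_real_iff summable_geometric)
  have "(\<lambda>m. (1 / 2 :: real) ^ m) sums 2" using geometric_sums[of "1 / 2 :: real"] by simp
  then have "infsum (\<lambda>m. (1 / 2 :: real) ^ m) UNIV = 2"
    using sums_nonneg_imp_has_sum infsumI by fastforce
  \<comment> \<open>\<open>infsum\<close> is 0 by default for families that are not summable, so the
    nonzero value, a product of factors 2, proves summability.\<close>
  then have "infsum (\<lambda>\<alpha> :: 'n \<Rightarrow> nat. \<Prod>k\<in>UNIV. (1 / 2 :: real) ^ \<alpha> k) (PiE UNIV (\<lambda>_. UNIV)) \<noteq> 0"
    by (subst infsum_prod_PiE_abs[OF finite geo]) auto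
  then show ?thesis by (metis PiE_UNIV infsum_not_exists)
qed

text \<open>The product of the one-variable Taylor series. Cauchy radius 2 against \<bar>t_k\<bar>
  \<le> 1 gives the geometric majorant, with Gaussian decay in s for the later integration.\<close>

lemma gaussn_deriv_0_has_sum:
  fixes s t :: "'n::finite rvec"
  assumes t: "\<And>k. \<bar>t $ k\<bar> \<le> 1"
  shows "((\<lambda>\<alpha>. (\<Prod>k\<in>UNIV. (t $ k) ^ \<alpha> k / fact (\<alpha> k)) *\<^sub>R gaussn_deriv \<alpha> s) has_sum gaussn_deriv (\<lambda>_. 0) (s + t)) UNIV"
    and "norm ((\<Prod>k\<in>UNIV. (t $ k) ^ \<alpha> k / fact (\<alpha> k)) *\<^sub>R gaussn_deriv \<alpha> s)
      \<le> (\<Prod>k\<in>UNIV. (1 / 2) ^ \<alpha> k) * (exp (real CARD('n) * 2\<^sup>2) * exp (- (1 / 4) * (norm s)\<^sup>2))"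
proof -
  let ?f = "\<lambda>k m. gauss_deriv m (s $ k) / fact m * of_real (t $ k) ^ m"
  let ?g = "\<lambda>\<alpha>. (\<Prod>k\<in>UNIV. (t $ k) ^ \<alpha> k / fact (\<alpha> k)) *\<^sub>R gaussn_deriv \<alpha> s"
  have g: "?g = (\<lambda>\<alpha>. \<Prod>k\<in>UNIV. ?f k (\<alpha> k))"
    by (simp add: gaussn_deriv_def scaleR_conv_of_real fun_eq_iff mult_ac flip: prod.distrib)
  show bound: "norm (?g \<alpha>) \<le> (\<Prod>k\<in>UNIV. (1 / 2) ^ \<alpha> k) * (exp (real CARD('n) * 2\<^sup>2) * exp (- (1 / 4) * (norm s)\<^sup>2))" for \<alpha>
  proof -
    have "norm (?g \<alpha>) = (\<Prod>k\<in>UNIV. \<bar>t $ k\<bar> ^ \<alpha> k / fact (\<alpha> k)) * norm (gaussn_deriv \<alpha> s)"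
      by (simp add: power_abs abs_prod)
    also have "\<dots> \<le> (\<Prod>k\<in>UNIV. 1 / fact (\<alpha> k)) *
        (exp (real CARD('n) * 2\<^sup>2) * (\<Prod>k\<in>UNIV. fact (\<alpha> k) / 2 ^ \<alpha> k) * exp (- (norm s)\<^sup>2 / 4))"
      using t by (intro mult_mono prod_mono conjI divide_right_mono norm_gaussn_deriv_le)
        (auto simp: power_le_one intro!: prod_nonneg)
    also have "\<dots> = (\<Prod>k\<in>UNIV. 1 / fact (\<alpha> k) * (fact (\<alpha> k) / 2 ^ \<alpha> k)) * (exp (real CARD('n) * 2\<^sup>2) * exp (- (norm s)\<^sup>2 / 4))"
      by (simp only: prod.distrib mult_ac)
    also have "\<dots> = (\<Prod>k\<in>UNIV. (1 / 2) ^ \<alpha> k) * (exp (real CARD('n) * 2\<^sup>2) * exp (- (1 / 4) * (norm s)\<^sup>2))"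
      by (simp add: power_one_over)
    finally show ?thesis .
  qed
  have geo: "summable (\<lambda>m. (exp (2\<^sup>2) * exp (- u\<^sup>2 / 4)) * (1 / 2 :: real) ^ m)" for u
    by (intro summable_mult summable_geometric) simp
  have sm: "summable (\<lambda>m. norm (?f k m))" for k
  proof (rule summable_comparison_test'[OF geo[of "s $ k"], of 0])
    fix m
    have "norm (?f k m) \<le> norm (gauss_deriv m (s $ k)) / fact m * 1"
      unfolding norm_mult norm_divide norm_power using t[of k]
      by (intro mult_mono) (auto simp: power_le_one norm_fact)
    also have "\<dots> \<le> (fact m * (exp (2\<^sup>2) * exp (- (s $ k)\<^sup>2 / 4)) / 2 ^ m) / fact m * 1"
      by (intro mult_right_mono divide_right_mono norm_gauss_deriv_le) auto
    finally show "norm (norm (?f k m)) \<le> (exp (2\<^sup>2) * exp (- (s $ k)\<^sup>2 / 4)) * (1 / 2) ^ m"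
      by (simp add: power_one_over)
  qed
  have "(?f k has_sum gauss_deriv 0 (s $ k + t $ k)) UNIV" for k
    by (rule norm_summable_imp_has_sum[OF sm gauss_deriv_sums])
  then have "infsum (?f k) UNIV = gauss_deriv 0 (s $ k + t $ k)" for k
    by (rule infsumI)
  moreover have "(\<lambda>m. norm (?f k m)) summable_on UNIV" for k
    using sm[of k] by (simp add: summable_on_UNIV_nonneg_real_iff)
  ultimately have "infsum ?g UNIV = gaussn_deriv (\<lambda>_. 0) (s + t)"
    unfolding g using infsum_prod_PiE_abs[of UNIV ?f "\<lambda>_. UNIV"] by (simp add: gaussn_deriv_def)
  then show "(?g has_sum gaussn_deriv (\<lambda>_. 0) (s + t)) UNIV"
  proof (rule subst)
    have "?g summable_on UNIV"
      by (rule Infinite_Sum.abs_summable_summable, rule Infinite_Sum.abs_summable_on_comparison_test'[OF _ bound])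
        (intro summable_on_cmult_left summable_on_geometric_multi)
    then show "(?g has_sum infsum ?g UNIV) UNIV" by (rule has_sum_infsum)
  qed
qed

text \<open>An enumeration of the index type reduces this to sequences; absolute convergence then
  restores the unordered sum.\<close>

lemma has_sum_integral_dominated:
  fixes f :: "'i::countable \<Rightarrow> 'a \<Rightarrow> 'b::{banach,second_countable_topology}"
  assumes inf: "infinite (UNIV :: 'i set)"
    and f: "\<And>i. f i \<in> borel_measurable M"
    and bound: "\<And>i z. norm (f i z) \<le> c i * G z"
    and c: "c summable_on UNIV" and G: "integrable M G"
    and S: "\<And>z. ((\<lambda>i. f i z) has_sum S z) UNIV"
  shows "((\<lambda>i. \<integral>z. f i z \<partial>M) has_sum (\<integral>z. S z \<partial>M)) UNIV"
proof -
  define \<phi> where "\<phi> = from_nat_into (UNIV :: 'i set)"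
  have \<phi>: "bij_betw \<phi> UNIV UNIV"
    unfolding \<phi>_def using inf by (intro bij_betw_from_nat_into) auto
  have c': "summable (\<lambda>m. c (\<phi> m))"
    using c by (intro summable_on_imp_summable) (simp add: summable_on_reindex_bij_betw[OF \<phi>])
  have S': "(\<Sum>m. f (\<phi> m) z) = S z" for z
  proof -
    have "((\<lambda>m. f (\<phi> m) z) has_sum S z) UNIV"
      using S[of z] has_sum_reindex_bij_betw[OF \<phi>, of "\<lambda>i. f i z"] by simp
    then show ?thesis by (simp add: has_sum_imp_sums sums_unique[symmetric])
  qed
  have int: "integrable M (f i)" for i
    by (rule Bochner_Integration.integrable_bound[OF integrable_mult_right[OF G, of "c i"] f])
      (use bound[of i] in \<open>auto intro: order_trans[OF _ abs_ge_self]\<close>)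
  have "(\<lambda>m. \<integral>z. f (\<phi> m) z \<partial>M) sums (\<integral>z. S z \<partial>M)"
    using sums_integral_dominated[of "\<lambda>m. f (\<phi> m)" M "\<lambda>m. c (\<phi> m)" G, OF f bound c' G] by (simp add: S')
  moreover have "summable (\<lambda>m. norm (\<integral>z. f (\<phi> m) z \<partial>M))"
  proof (rule summable_comparison_test'[OF summable_mult2[OF c', of "\<integral>z. G z \<partial>M"], of 0])
    fix m
    have "norm (\<integral>z. f (\<phi> m) z \<partial>M) \<le> (\<integral>z. norm (f (\<phi> m) z) \<partial>M)" by (rule integral_norm_bound)
    also have "\<dots> \<le> (\<integral>z. c (\<phi> m) * G z \<partial>M)"
      by (intro integral_mono int integrable_norm integrable_mult_right G bound)
    finally show "norm (norm (\<integral>z. f (\<phi> m) z \<partial>M)) \<le> c (\<phi> m) * (\<integral>z. G z \<partial>M)" by simp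
  qed
  ultimately have "((\<lambda>m. \<integral>z. f (\<phi> m) z \<partial>M) has_sum (\<integral>z. S z \<partial>M)) UNIV"
    by (intro norm_summable_imp_has_sum)
  then show ?thesis
    using has_sum_reindex_bij_betw[OF \<phi>, of "\<lambda>i. \<integral>z. f i z \<partial>M"] by simp
qed

lemma real_analytic_gauss_conv:
  fixes h :: "'n::{finite,linorder} rvec \<Rightarrow> ('n, 'q::{finite,linorder}) cliff"
  assumes h: "h \<in> L2C lborel"
  shows "real_analytic (\<lambda>x. \<kappa> *\<^sub>R gauss_conv (\<lambda>_. 0) h x)"
  unfolding real_analytic_def
\<comment> \<open>The witnesses are fixed by the facts below: radius 1 at every centre a, and
  coefficients \<kappa>/\<alpha>! times \<open>gauss_conv \<alpha> h a\<close>.\<close>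
proof (intro allI exI conjI ballI)
  fix a x :: "'n rvec"
  assume "x \<in> ball a 1"
  then have t: "\<bar>(x - a) $ k\<bar> \<le> 1" for k
    using component_le_norm_cart[of "x - a" k] by (simp add: dist_norm norm_minus_commute)
  note G = gaussn_deriv_0_has_sum[OF t]
  let ?w = "\<lambda>\<alpha>. \<Prod>k\<in>UNIV. ((x - a) $ k) ^ \<alpha> k / fact (\<alpha> k)"
  let ?f = "\<lambda>\<alpha> z. (?w \<alpha> *\<^sub>R gaussn_deriv \<alpha> (a - z)) *s h z"
  have "((\<lambda>\<alpha>. \<integral>z. ?f \<alpha> z \<partial>lborel) has_sum (\<integral>z. gaussn_deriv (\<lambda>_. 0) (a - z + (x - a)) *s h z \<partial>lborel)) UNIV"
  proof (rule has_sum_integral_dominated[OF _ _ _ summable_on_geometric_multi])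
    show "infinite (UNIV :: ('n \<Rightarrow> nat) set)" using finite_fun_UNIVD2 by blast
    show "?f \<alpha> \<in> borel_measurable lborel" for \<alpha>
      unfolding smult.scaleR_left
      by (intro borel_measurable_scaleR borel_measurable_const borel_measurable_gauss_conv_integrand h)
    show "integrable lborel (\<lambda>z. exp (real CARD('n) * 2\<^sup>2) * (exp (- (1 / 4) * (norm (a - z))\<^sup>2) * norm (h z)))"
      by (intro integrable_mult_right integrable_gauss_L2C h) simp
    show "((\<lambda>\<alpha>. ?f \<alpha> z) has_sum gaussn_deriv (\<lambda>_. 0) (a - z + (x - a)) *s h z) UNIV" for z
      by (rule has_sum_bounded_linear[OF smult.bounded_linear_left G(1)])
    show "norm (?f \<alpha> z) \<le> (\<Prod>k\<in>UNIV. (1 / 2) ^ \<alpha> k) *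
        (exp (real CARD('n) * 2\<^sup>2) * (exp (- (1 / 4) * (norm (a - z))\<^sup>2) * norm (h z)))" for \<alpha> z
      using mult_right_mono[OF G(2)[of \<alpha> "a - z"] norm_ge_zero[of "h z"]]
      by (simp only: norm_vector_scalar_mult mult.assoc)
  qed
  then have "((\<lambda>\<alpha>. ?w \<alpha> *\<^sub>R gauss_conv \<alpha> h a) has_sum gauss_conv (\<lambda>_. 0) h x) UNIV"
    unfolding gauss_conv_def smult.scaleR_left by (simp add: add.commute)
  from has_sum_bounded_linear[OF bounded_linear_scaleR_right this, of \<kappa>]
  show "((\<lambda>\<alpha>. (\<Prod>k\<in>UNIV. (x $ k - a $ k) ^ \<alpha> k) *\<^sub>R ((\<kappa> / (\<Prod>k\<in>UNIV. fact (\<alpha> k))) *\<^sub>R gauss_conv \<alpha> h a))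
      has_sum \<kappa> *\<^sub>R gauss_conv (\<lambda>_. 0) h x) UNIV"
    by (simp add: prod_dividef mult.commute)
qed simp

section \<open>Gaussians as test functions\<close>

text \<open>The classical flat function exp(-1/s), extended by 0. The powers s^j in the denominator
  make the linear span of the family closed under differentiation.\<close>

definition flat_exp :: "nat \<Rightarrow> real \<Rightarrow> real" where
  "flat_exp j s = (if 0 < s then exp (- 1 / s) / s ^ j else 0)"

lemma flat_exp_nonneg: "0 \<le> flat_exp j s"
  by (simp add: flat_exp_def)

text \<open>The bound of a power over a factorial by the exponential, taken at 1/s and
  inverted.\<close>

lemma exp_minus_inverse_le: "0 < s \<Longrightarrow> exp (- 1 / s) \<le> fact m * s ^ m" for s :: real
proof -
  assume s: "0 < s"
  have "(1 / s) ^ m / fact m \<le> exp (1 / s)"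
    by (rule power_div_fact_le_exp) (use s in simp)
  then show ?thesis
    using s by (simp add: exp_minus field_simps)
qed

lemma flat_exp_le_fact: "flat_exp j s \<le> fact j"
  using exp_minus_inverse_le[of s j] by (simp add: flat_exp_def field_simps)

lemma abs_flat_exp_le: "\<bar>flat_exp j s\<bar> \<le> fact (Suc j) * \<bar>s\<bar>"
proof (cases "0 < s")
  case True
  then have "exp (- 1 / s) / s ^ j \<le> fact (Suc j) * s ^ Suc j / s ^ j"
    by (intro divide_right_mono exp_minus_inverse_le) auto
  then show ?thesis using True by (simp add: flat_exp_def)
qed (simp add: flat_exp_def mult_nonneg_nonpos del: fact_Suc)

lemma DERIV_flat_exp: "(flat_exp j has_real_derivative flat_exp (j + 2) s - real j * flat_exp (j + 1) s) (at s)"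
proof (cases s "0 :: real" rule: linorder_cases)
  case less
  have "((\<lambda>_. 0) has_real_derivative 0) (at s)" by simp
  then have "(flat_exp j has_real_derivative 0) (at s)"
    by (rule has_field_derivative_transform_within_open[of _ _ _ "{..<0}"]) (use less in \<open>auto simp: flat_exp_def\<close>)
  then show ?thesis using less by (simp add: flat_exp_def)
next
  case equal
  \<comment> \<open>The difference quotient at 0 is the member of index j + 1, which is bounded by a
    multiple of \<bar>h\<bar>.\<close>
  have "(\<lambda>h. (flat_exp j (0 + h) - flat_exp j 0) / h) \<midarrow>0\<rightarrow> 0"
  proof (rule Lim_null_comparison)
    have "norm ((flat_exp j (0 + h) - flat_exp j 0) / h) \<le> fact (Suc (Suc j)) * \<bar>h\<bar>" for h
      using abs_flat_exp_le[of "Suc j" h] by (auto simp: flat_exp_def field_simps)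
    then show "\<forall>\<^sub>F h in at 0. norm ((flat_exp j (0 + h) - flat_exp j 0) / h) \<le> fact (Suc (Suc j)) * \<bar>h\<bar>"
      by simp
    show "(\<lambda>h. fact (Suc (Suc j)) * \<bar>h\<bar> :: real) \<midarrow>0\<rightarrow> 0"
      by (auto intro!: tendsto_eq_intros)
  qed
  then show ?thesis using equal by (simp add: DERIV_def flat_exp_def)
next
  case greater
  have "((\<lambda>s. exp (- 1 / s) / s ^ j) has_real_derivative exp (- 1 / s) / s ^ (j + 2) - real j * (exp (- 1 / s) / s ^ (j + 1))) (at s)"
  proof -
    have pow: "real j * s ^ (j - 1) = real j * s ^ j / s"
      using greater by (cases j) auto
    have "((\<lambda>s. exp (- 1 / s) / s ^ j) has_real_derivative
        ((1 / s\<^sup>2 * exp (- 1 / s)) * s ^ j - exp (- 1 / s) * (real j * s ^ (j - 1))) / (s ^ j * s ^ j)) (at s)"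
      using greater by (intro DERIV_divide) (auto intro!: derivative_eq_intros simp: power2_eq_square)
    also have "((1 / s\<^sup>2 * exp (- 1 / s)) * s ^ j - exp (- 1 / s) * (real j * s ^ (j - 1))) / (s ^ j * s ^ j)
        = exp (- 1 / s) / s ^ (j + 2) - real j * (exp (- 1 / s) / s ^ (j + 1))"
      using greater unfolding pow by (simp add: diff_divide_distrib power2_eq_square)
    finally show ?thesis .
  qed
  then have "(flat_exp j has_real_derivative exp (- 1 / s) / s ^ (j + 2) - real j * (exp (- 1 / s) / s ^ (j + 1))) (at s)"
    by (rule has_field_derivative_transform_within_open[of _ _ _ "{0<..}"]) (use greater in \<open>auto simp: flat_exp_def\<close>)
  then show ?thesis using greater by (simp add: flat_exp_def)
qed

text \<open>A class of functions containing the factors of the cut-off Gaussian and closed under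
  derivatives; this yields smoothness without computing higher derivatives.\<close>

inductive_set cutoff_functions :: "real \<Rightarrow> (real \<Rightarrow> real) set" for R where
  const: "(\<lambda>_. c) \<in> cutoff_functions R"
| ident: "(\<lambda>t. t) \<in> cutoff_functions R"
| gauss: "(\<lambda>t. exp (- (a - t)\<^sup>2 / 2)) \<in> cutoff_functions R"
| bump: "(\<lambda>t. flat_exp j (1 - (t / R)\<^sup>2)) \<in> cutoff_functions R"
| add: "f \<in> cutoff_functions R \<Longrightarrow> g \<in> cutoff_functions R \<Longrightarrow> (\<lambda>t. f t + g t) \<in> cutoff_functions R"
| mult: "f \<in> cutoff_functions R \<Longrightarrow> g \<in> cutoff_functions R \<Longrightarrow> (\<lambda>t. f t * g t) \<in> cutoff_functions R"

lemma cutoff_functions_derivative: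
  "f \<in> cutoff_functions R \<Longrightarrow> \<exists>f'\<in>cutoff_functions R. \<forall>t. (f has_real_derivative f' t) (at t)"
proof (induction rule: cutoff_functions.induct)
  case (const c)
  show ?case by (rule bexI[OF _ cutoff_functions.const[of 0]]) simp
next
  case ident
  show ?case by (rule bexI[OF _ cutoff_functions.const[of 1]]) simp
next
  case (gauss a)
  show ?case
  proof (rule bexI[of _ "\<lambda>t. (a + (- 1) * t) * exp (- (a - t)\<^sup>2 / 2)"])
    show "\<forall>t. ((\<lambda>t. exp (- (a - t)\<^sup>2 / 2)) has_real_derivative (a + (- 1) * t) * exp (- (a - t)\<^sup>2 / 2)) (at t)"
      by (auto intro!: derivative_eq_intros simp: field_simps)
  qed (intro cutoff_functions.intros)
next
  case (bump j)
  show ?case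
  proof (rule bexI[of _ "\<lambda>t. (flat_exp (j + 2) (1 - (t / R)\<^sup>2) + - real j * flat_exp (j + 1) (1 - (t / R)\<^sup>2)) * (- 2 / R\<^sup>2 * t)"])
    show "\<forall>t. ((\<lambda>t. flat_exp j (1 - (t / R)\<^sup>2)) has_real_derivative
        (flat_exp (j + 2) (1 - (t / R)\<^sup>2) + - real j * flat_exp (j + 1) (1 - (t / R)\<^sup>2)) * (- 2 / R\<^sup>2 * t)) (at t)"
    proof
      fix t
      have "((\<lambda>t. 1 - (t / R)\<^sup>2) has_real_derivative - 2 / R\<^sup>2 * t) (at t)"
        \<comment> \<open>For R = 0 division by zero gives 0, so both the function and the claimed
          derivative are constant.\<close>
        by (cases "R = 0") (auto intro!: derivative_eq_intros simp: power2_eq_square)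
      from DERIV_chain2[OF DERIV_flat_exp this]
      show "((\<lambda>t. flat_exp j (1 - (t / R)\<^sup>2)) has_real_derivative
        (flat_exp (j + 2) (1 - (t / R)\<^sup>2) + - real j * flat_exp (j + 1) (1 - (t / R)\<^sup>2)) * (- 2 / R\<^sup>2 * t)) (at t)"
        by simp
    qed
  qed (intro cutoff_functions.intros)
next
  case (add f g)
  then obtain f' g' where "f' \<in> cutoff_functions R" "\<And>t. (f has_real_derivative f' t) (at t)"
    "g' \<in> cutoff_functions R" "\<And>t. (g has_real_derivative g' t) (at t)" by blast
  then show ?case
    by (intro bexI[of _ "\<lambda>t. f' t + g' t"] cutoff_functions.add) (auto intro: DERIV_add)
next
  case (mult f g)
  then obtain f' g' where "f' \<in> cutoff_functions R" "\<And>t. (f has_real_derivative f' t) (at t)"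
    "g' \<in> cutoff_functions R" "\<And>t. (g has_real_derivative g' t) (at t)" by blast
  with mult show ?case
    by (intro bexI[of _ "\<lambda>t. f' t * g t + g' t * f t"] cutoff_functions.add cutoff_functions.mult)
      (auto intro: DERIV_mult)
qed

lemma cutoff_functions_deriv:
  assumes "f \<in> cutoff_functions R"
  shows "(deriv ^^ m) f \<in> cutoff_functions R"
    and "((deriv ^^ m) f has_real_derivative (deriv ^^ Suc m) f t) (at t)"
proof -
  have step: "deriv f \<in> cutoff_functions R \<and> (f has_real_derivative deriv f t) (at t)"
    if f: "f \<in> cutoff_functions R" for f t
  proof -
    obtain f' where f': "f' \<in> cutoff_functions R" "\<And>t. (f has_real_derivative f' t) (at t)"
      using cutoff_functions_derivative[OF f] by blast
    then have "deriv f = f'" by (auto intro: DERIV_imp_deriv)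
    with f' show ?thesis by simp
  qed
  show mem: "(deriv ^^ m) f \<in> cutoff_functions R"
    by (induction m) (simp_all add: assms step)
  show "((deriv ^^ m) f has_real_derivative (deriv ^^ Suc m) f t) (at t)"
    using step[OF mem] by simp
qed

lemma foldr_partial_prod:
  fixes \<eta> :: "'n::finite \<Rightarrow> real \<Rightarrow> real"
  assumes \<eta>: "\<And>k m t. ((deriv ^^ m) (\<eta> k) has_real_derivative (deriv ^^ Suc m) (\<eta> k) t) (at t)"
  shows "foldr partial ks (\<lambda>z. \<Prod>k\<in>UNIV. \<eta> k (z $ k)) = (\<lambda>z. \<Prod>k\<in>UNIV. (deriv ^^ count_list ks k) (\<eta> k) (z $ k))"
proof (induction ks)
  case (Cons j ks)
  show ?case
  proof
    fix z :: "'n rvec"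
    have "partial j (\<lambda>z. \<Prod>k\<in>UNIV. (deriv ^^ count_list ks k) (\<eta> k) (z $ k)) z
      = (\<Prod>k\<in>UNIV. (deriv ^^ count_list (j # ks) k) (\<eta> k) (z $ k))"
      unfolding count_list_Cons
      using \<eta> partial_prod[of "\<lambda>k m. (deriv ^^ m) (\<eta> k)" "count_list ks" z j 0]
      by (intro ddir_eqI) (simp add: has_real_derivative_iff_has_vector_derivative)
    then show "foldr partial (j # ks) (\<lambda>z. \<Prod>k\<in>UNIV. \<eta> k (z $ k)) z
      = (\<Prod>k\<in>UNIV. (deriv ^^ count_list (j # ks) k) (\<eta> k) (z $ k))"
      using Cons by simp
  qed
qed simp

text \<open>Iterated partials act on each factor separately, so differentiability reduces to one
  variable; the support lies in a cube of half-side R.\<close>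

lemma test_function_prod:
  fixes \<eta> :: "'n::finite \<Rightarrow> real \<Rightarrow> real"
  assumes \<eta>: "\<And>k. \<eta> k \<in> cutoff_functions R"
    and supp: "\<And>k t. R \<le> \<bar>t\<bar> \<Longrightarrow> \<eta> k t = 0"
  shows "test_function (\<lambda>z. \<Prod>k\<in>UNIV. \<eta> k (z $ k))"
  unfolding test_function_def
proof (intro conjI allI)
  note d = cutoff_functions_deriv(2)[OF \<eta>]
  fix ks :: "'n list" and z :: "'n rvec"
  have "((\<lambda>z. (deriv ^^ m) (\<eta> k) (z $ k)) has_derivative (\<lambda>h. (deriv ^^ Suc m) (\<eta> k) (z $ k) * h $ k)) (at z)" for k m
    using has_derivative_compose[OF bounded_linear_imp_has_derivative[OF bounded_linear_vec_nth]
        d[of m k "z $ k", unfolded has_field_derivative_def]] by simp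
  then have "((\<lambda>z. \<Prod>k\<in>UNIV. (deriv ^^ count_list ks k) (\<eta> k) (z $ k)) has_derivative
      (\<lambda>h. \<Sum>k\<in>UNIV. (deriv ^^ Suc (count_list ks k)) (\<eta> k) (z $ k) * h $ k *
        (\<Prod>j\<in>UNIV - {k}. (deriv ^^ count_list ks j) (\<eta> j) (z $ j)))) (at z)"
    by (rule has_derivative_prod)
  then have "(\<lambda>z. \<Prod>k\<in>UNIV. (deriv ^^ count_list ks k) (\<eta> k) (z $ k)) differentiable (at z)"
    by (rule differentiableI)
  then show "foldr partial ks (\<lambda>z. \<Prod>k\<in>UNIV. \<eta> k (z $ k)) differentiable (at z)"
    by (simp only: foldr_partial_prod[of \<eta>, OF d])
next
  have "norm z \<le> real CARD('n) * R" if "(\<Prod>k\<in>UNIV. \<eta> k (z $ k)) \<noteq> 0" for z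
  proof -
    have "\<bar>z $ k\<bar> \<le> R" for k
      using that supp[of "z $ k" k] by (cases "R \<le> \<bar>z $ k\<bar>") auto
    then have "(\<Sum>k\<in>UNIV. \<bar>z $ k\<bar>) \<le> real CARD('n) * R"
      by (intro sum_bounded_above) auto
    then show ?thesis using norm_le_l1_cart[of z] by linarith
  qed
  then have "bounded {z. (\<Prod>k\<in>UNIV. \<eta> k (z $ k)) \<noteq> 0}"
    unfolding bounded_iff by blast
  then show "compact (closure {z. (\<Prod>k\<in>UNIV. \<eta> k (z $ k)) \<noteq> 0})"
    by simp
qed

text \<open>The Gaussian E is the limit of the test functions \<phi> R, and their k-th partials tend
  to (x_k - z_k) E because the derivative of the cut-off tends to 0. Dominated convergence passes
  the weak identity to the limit.\<close>

lemma weak_partial_gauss: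
  fixes x :: "'n::finite rvec"
  assumes u: "u \<in> L2 lborel" and v: "v \<in> L2 lborel" and uv: "weak_partial k u v"
  shows "(\<integral>z. u z * complex_of_real ((x $ k - z $ k) * exp (- (norm (x - z))\<^sup>2 / 2)) \<partial>lborel)
    = - (\<integral>z. v z * complex_of_real (exp (- (norm (x - z))\<^sup>2 / 2)) \<partial>lborel)"
proof -
  define E where "E z = exp (- (norm (x - z))\<^sup>2 / 2)" for z
  \<comment> \<open>The factor exp 1 gives the cut-off the value 1 at t = 0, hence the pointwise
    limit 1 as R grows.\<close>
  define b where "b R t = exp 1 * flat_exp 0 (1 - (t / R)\<^sup>2)" for R t
  define b' where "b' R t = exp 1 * flat_exp 2 (1 - (t / R)\<^sup>2) * (- 2 / R\<^sup>2 * t)" for R t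
  define \<eta> where "\<eta> R j t = exp (- (x $ j - t)\<^sup>2 / 2) * b R t" for R j t
  define \<phi> where "\<phi> R z = (\<Prod>j\<in>UNIV. \<eta> R j (z $ j))" for R and z :: "'n rvec"
  define \<phi>' where "\<phi>' R z = (x $ k - z $ k) * \<phi> R z + E z * (b' R (z $ k) * (\<Prod>j\<in>UNIV - {k}. b R (z $ j)))" for R z
  have b: "0 \<le> b R t" "b R t \<le> 1" for R t
  proof -
    show "0 \<le> b R t" by (simp add: b_def flat_exp_nonneg)
    show "b R t \<le> 1"
    proof (cases "0 < 1 - (t / R)\<^sup>2")
      case True
      then have "1 \<le> 1 / (1 - (t / R)\<^sup>2)" by (subst le_divide_eq_1_pos) auto
      then show ?thesis using True by (simp add: b_def flat_exp_def flip: exp_add)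
    qed (simp add: b_def flat_exp_def)
  qed
  \<comment> \<open>Inside the support \<bar>t\<bar> < R, so the inner derivative is at most 2/R
    \<le> 2, and \<open>flat_exp 2\<close> is at most 2! = 2.\<close>
  have b': "\<bar>b' R t\<bar> \<le> 4 * exp 1" if "1 \<le> R" for R t
  proof (cases "0 < 1 - (t / R)\<^sup>2")
    case True
    then have "(t / R)\<^sup>2 < 1\<^sup>2" by simp
    then have "\<bar>t / R\<bar> < 1" by (simp add: power2_less_imp_less abs_square_less_1)
    then have "\<bar>2 / R\<^sup>2 * t\<bar> \<le> 2 * 1"
      using that by (simp add: abs_mult power2_eq_square field_simps) (smt (verit) mult_le_cancel_left1)
    moreover have "\<bar>flat_exp 2 (1 - (t / R)\<^sup>2)\<bar> \<le> 2"
      using flat_exp_le_fact[of 2 "1 - (t / R)\<^sup>2"] flat_exp_nonneg[of 2 "1 - (t / R)\<^sup>2"] by simp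
    ultimately have "\<bar>flat_exp 2 (1 - (t / R)\<^sup>2)\<bar> * \<bar>2 / R\<^sup>2 * t\<bar> \<le> 2 * 2"
      by (intro mult_mono) auto
    then have "exp 1 * (\<bar>flat_exp 2 (1 - (t / R)\<^sup>2)\<bar> * \<bar>2 / R\<^sup>2 * t\<bar>) \<le> exp 1 * (2 * 2)"
      by (rule mult_left_mono) simp
    then show ?thesis by (simp add: b'_def abs_mult mult_ac)
  qed (simp add: b'_def flat_exp_def)
  have E_prod: "E z = (\<Prod>j\<in>UNIV. exp (- (x $ j - z $ j)\<^sup>2 / 2))" for z
    using exp_norm_square_vec[of "- 1 / 2" "x - z"] by (simp add: E_def)
  have \<phi>_eq: "\<phi> R z = E z * (\<Prod>j\<in>UNIV. b R (z $ j))" for R z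
    by (simp add: \<phi>_def \<eta>_def E_prod prod.distrib)
  have \<eta>_mem: "\<eta> R j \<in> cutoff_functions R" for R j
    unfolding \<eta>_def b_def by (intro cutoff_functions.intros)
  have test: "test_function (\<phi> R)" if "1 \<le> R" for R
    unfolding \<phi>_def
  proof (rule test_function_prod[OF \<eta>_mem])
    fix j t assume "R \<le> \<bar>t\<bar>"
    then have "R\<^sup>2 \<le> \<bar>t\<bar>\<^sup>2" using that by (intro power_mono) auto
    then have "\<not> 0 < 1 - (t / R)\<^sup>2" using that by (simp add: power_divide)
    then show "\<eta> R j t = 0" by (simp add: \<eta>_def b_def flat_exp_def)
  qed
  have deriv_\<phi>: "partial k (\<phi> R) z = \<phi>' R z" for R z
  proof -
    have *: "\<phi> R (z + t *\<^sub>R axis k 1) = \<eta> R k (z $ k + t) * (\<Prod>j\<in>UNIV - {k}. \<eta> R j (z $ j))" for t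
      unfolding \<phi>_def by (subst prod.remove[of _ k]) (auto simp: axis_def intro!: prod.cong)
    have "((\<lambda>t. 1 - ((z $ k + t) / R)\<^sup>2) has_real_derivative - 2 / R\<^sup>2 * z $ k) (at 0)"
      by (cases "R = 0") (auto intro!: derivative_eq_intros simp: power2_eq_square)
    from DERIV_chain2[OF DERIV_flat_exp this, of 0]
    have "((\<lambda>t. b R (z $ k + t)) has_real_derivative b' R (z $ k)) (at 0)"
      unfolding b_def b'_def by (auto intro!: derivative_eq_intros simp: numeral_2_eq_2)
    then have "((\<lambda>t. \<eta> R k (z $ k + t)) has_real_derivative
        (x $ k - z $ k) * \<eta> R k (z $ k) + exp (- (x $ k - z $ k)\<^sup>2 / 2) * b' R (z $ k)) (at 0)"
      unfolding \<eta>_def by (auto intro!: derivative_eq_intros simp: field_simps)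
    then have "((\<lambda>t. \<phi> R (z + t *\<^sub>R axis k 1)) has_real_derivative
        ((x $ k - z $ k) * \<eta> R k (z $ k) + exp (- (x $ k - z $ k)\<^sup>2 / 2) * b' R (z $ k)) * (\<Prod>j\<in>UNIV - {k}. \<eta> R j (z $ j))) (at 0)"
      unfolding * by (rule DERIV_cmult_right)
    moreover have "((x $ k - z $ k) * \<eta> R k (z $ k) + exp (- (x $ k - z $ k)\<^sup>2 / 2) * b' R (z $ k)) * (\<Prod>j\<in>UNIV - {k}. \<eta> R j (z $ j)) = \<phi>' R z"
    proof -
      have "E z = exp (- (x $ k - z $ k)\<^sup>2 / 2) * (\<Prod>j\<in>UNIV - {k}. exp (- (x $ j - z $ j)\<^sup>2 / 2))"
        unfolding E_prod by (subst prod.remove[of _ k]) auto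
      moreover have "\<phi> R z = \<eta> R k (z $ k) * (\<Prod>j\<in>UNIV - {k}. \<eta> R j (z $ j))"
        using *[of 0] by simp
      ultimately show ?thesis
        by (simp add: \<phi>'_def \<eta>_def prod.distrib algebra_simps)
    qed
    ultimately show ?thesis
      by (intro ddir_eqI) (simp add: has_real_derivative_iff_has_vector_derivative)
  qed
  have prod_b: "0 \<le> (\<Prod>j\<in>J. b R (z $ j)) \<and> (\<Prod>j\<in>J. b R (z $ j)) \<le> 1" for R J and z :: "'n rvec"
    by (auto intro: prod_nonneg prod_le_1 b)
  have E4: "E z \<le> exp (- (1 / 4) * (norm (x - z))\<^sup>2)" for z
    by (simp add: E_def)
  \<comment> \<open>The linear factor is absorbed by half of the exponent: \<bar>s\<bar> \<le> exp
    \<bar>s\<bar> \<le> exp(1 + \<bar>s\<bar>^2/4).\<close>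
  have E4': "\<bar>x $ k - z $ k\<bar> * E z \<le> exp 1 * exp (- (1 / 4) * (norm (x - z))\<^sup>2)" for z
  proof -
    have "norm (x - z) \<le> exp (norm (x - z))" using exp_ge_add_one_self[of "norm (x - z)"] by linarith
    also have "\<dots> \<le> exp (1 + (norm (x - z))\<^sup>2 / 4)"
    proof -
      have "0 \<le> (norm (x - z) / 2 - 1)\<^sup>2" by simp
      then show ?thesis by (simp add: power2_diff power_divide)
    qed
    finally have "\<bar>x $ k - z $ k\<bar> \<le> exp (1 + (norm (x - z))\<^sup>2 / 4)"
      using component_le_norm_cart[of "x - z" k] by simp
    then have "\<bar>x $ k - z $ k\<bar> * E z \<le> exp (1 + (norm (x - z))\<^sup>2 / 4) * E z"
      by (intro mult_right_mono) (auto simp: E_def)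
    also have "\<dots> = exp 1 * exp (- (1 / 4) * (norm (x - z))\<^sup>2)"
      unfolding E_def by (simp flip: exp_add)
    finally show ?thesis .
  qed
  have \<phi>_le: "\<bar>\<phi> R z\<bar> \<le> E z" for R z
    using prod_b[where J = UNIV and R = R and z = z]
    by (simp add: \<phi>_eq abs_mult E_def mult_left_le)
  \<comment> \<open>The 5 is 1 from the derivative of the Gaussian plus 4 from that of the
    cut-off.\<close>
  have \<phi>'_le: "\<bar>\<phi>' R z\<bar> \<le> 5 * exp 1 * exp (- (1 / 4) * (norm (x - z))\<^sup>2)" if R: "1 \<le> R" for R z
  proof -
    have "\<bar>\<phi>' R z\<bar> \<le> \<bar>x $ k - z $ k\<bar> * \<bar>\<phi> R z\<bar> + E z * (\<bar>b' R (z $ k)\<bar> * \<bar>\<Prod>j\<in>UNIV - {k}. b R (z $ j)\<bar>)"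
      unfolding \<phi>'_def by (rule order_trans[OF abs_triangle_ineq]) (simp add: abs_mult E_def)
    also have "\<dots> \<le> \<bar>x $ k - z $ k\<bar> * E z + exp (- (1 / 4) * (norm (x - z))\<^sup>2) * (4 * exp 1 * 1)"
      using prod_b[where J = "UNIV - {k}" and R = R and z = z] b'[OF R]
      by (intro add_mono mult_left_mono mult_mono \<phi>_le E4) auto
    also have "\<dots> \<le> 5 * exp 1 * exp (- (1 / 4) * (norm (x - z))\<^sup>2)"
      using E4'[of z] by simp
    finally show ?thesis .
  qed
  let ?R = "\<lambda>i. real (Suc i)"
  have R_lim: "(\<lambda>i. 1 - (t / ?R i)\<^sup>2) \<longlonglongrightarrow> 1 - 0\<^sup>2" for t
    by (intro tendsto_intros LIMSEQ_Suc[OF lim_const_over_n])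
  have flat_exp_lim: "(\<lambda>i. flat_exp j (1 - (t / ?R i)\<^sup>2)) \<longlonglongrightarrow> exp (- 1)" for j t
    using isCont_tendsto_compose[OF DERIV_isCont[OF DERIV_flat_exp[of j 1]], of "\<lambda>i. 1 - (t / ?R i)\<^sup>2"] R_lim[of t]
    by (simp add: flat_exp_def)
  have b_lim: "(\<lambda>i. b (?R i) t) \<longlonglongrightarrow> 1" for t
    using tendsto_mult_left[OF flat_exp_lim[of 0 t], of "exp 1"] by (simp add: b_def flip: exp_add)
  have b'_lim: "(\<lambda>i. b' (?R i) t) \<longlonglongrightarrow> 0" for t
  proof -
    \<comment> \<open>Splitting t/R^2 as (1/R)(t/R) exhibits two factors tending to 0.\<close>
    have "(\<lambda>i. exp 1 * flat_exp 2 (1 - (t / ?R i)\<^sup>2) * (- 2 * (1 / ?R i) * (t / ?R i))) \<longlonglongrightarrow> exp 1 * exp (- 1) * (- 2 * 0 * 0)"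
      by (intro tendsto_intros flat_exp_lim LIMSEQ_Suc[OF lim_const_over_n])
    then show ?thesis by (simp add: b'_def power2_eq_square)
  qed
  have \<phi>_lim: "(\<lambda>i. \<phi> (?R i) z) \<longlonglongrightarrow> E z" for z
  proof -
    have "(\<lambda>i. E z * (\<Prod>j\<in>UNIV. b (?R i) (z $ j))) \<longlonglongrightarrow> E z * (\<Prod>j\<in>(UNIV :: 'n set). 1)"
      by (intro tendsto_intros b_lim)
    then show ?thesis by (simp add: \<phi>_eq)
  qed
  have \<phi>'_lim: "(\<lambda>i. \<phi>' (?R i) z) \<longlonglongrightarrow> (x $ k - z $ k) * E z" for z
  proof -
    have "(\<lambda>i. \<phi>' (?R i) z) \<longlonglongrightarrow> (x $ k - z $ k) * E z + E z * (0 * (\<Prod>j\<in>UNIV - {k}. 1))"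
      unfolding \<phi>'_def by (intro tendsto_intros b_lim b'_lim \<phi>_lim)
    then show ?thesis by simp
  qed
  have flat_exp_meas [measurable]: "flat_exp j \<in> borel_measurable borel" for j
    by (intro borel_measurable_continuous_onI continuous_at_imp_continuous_on ballI DERIV_isCont[OF DERIV_flat_exp])
  have meas [measurable]: "\<phi> R \<in> borel_measurable borel" "\<phi>' R \<in> borel_measurable borel" "E \<in> borel_measurable borel" for R
    unfolding \<phi>'_def \<phi>_eq E_def b_def b'_def by measurable
  have um [measurable]: "u \<in> borel_measurable borel" and vm [measurable]: "v \<in> borel_measurable borel"
    using u v by (simp_all add: L2_def)
  have dom: "integrable lborel (\<lambda>z. 5 * exp 1 * (exp (- (1 / 4) * (norm (x - z))\<^sup>2) * norm (w z)))"
    if "w \<in> L2 lborel" for w :: "'n rvec \<Rightarrow> complex"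
    using that by (intro integrable_mult_right integrable_gauss_square_integrable) (auto simp: L2_def)
  have "(\<lambda>i. \<integral>z. u z * of_real (\<phi>' (?R i) z) \<partial>lborel) \<longlonglongrightarrow> (\<integral>z. u z * of_real ((x $ k - z $ k) * E z) \<partial>lborel)"
  proof (rule integral_dominated_convergence[OF _ _ dom[OF u]])
    show "AE z in lborel. (\<lambda>i. u z * of_real (\<phi>' (?R i) z)) \<longlonglongrightarrow> u z * of_real ((x $ k - z $ k) * E z)"
      by (intro AE_I2 tendsto_intros \<phi>'_lim)
    show "AE z in lborel. norm (u z * of_real (\<phi>' (?R i) z)) \<le> 5 * exp 1 * (exp (- (1 / 4) * (norm (x - z))\<^sup>2) * norm (u z))" for i
    proof (rule AE_I2)
      fix z
      from mult_right_mono[OF \<phi>'_le[of "?R i" z] norm_ge_zero[of "u z"]]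
      show "norm (u z * of_real (\<phi>' (?R i) z)) \<le> 5 * exp 1 * (exp (- (1 / 4) * (norm (x - z))\<^sup>2) * norm (u z))"
        by (simp add: norm_mult mult_ac)
    qed
  qed measurable
  moreover have "(\<lambda>i. \<integral>z. v z * of_real (\<phi> (?R i) z) \<partial>lborel) \<longlonglongrightarrow> (\<integral>z. v z * of_real (E z) \<partial>lborel)"
  proof (rule integral_dominated_convergence[OF _ _ dom[OF v]])
    show "AE z in lborel. (\<lambda>i. v z * of_real (\<phi> (?R i) z)) \<longlonglongrightarrow> v z * of_real (E z)"
      by (intro AE_I2 tendsto_intros \<phi>_lim)
    show "AE z in lborel. norm (v z * of_real (\<phi> (?R i) z)) \<le> 5 * exp 1 * (exp (- (1 / 4) * (norm (x - z))\<^sup>2) * norm (v z))" for i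
    proof (rule AE_I2)
      fix z
      have "1 \<le> 5 * exp (1 :: real)" using exp_ge_add_one_self[of "1 :: real"] by linarith
      then have "1 * exp (- (1 / 4) * (norm (x - z))\<^sup>2) \<le> 5 * exp 1 * exp (- (1 / 4) * (norm (x - z))\<^sup>2)"
        by (intro mult_right_mono) auto
      then have "\<bar>\<phi> (?R i) z\<bar> \<le> 5 * exp 1 * exp (- (1 / 4) * (norm (x - z))\<^sup>2)"
        using \<phi>_le[of "?R i" z] E4[of z] by linarith
      from mult_right_mono[OF this norm_ge_zero[of "v z"]]
      show "norm (v z * of_real (\<phi> (?R i) z)) \<le> 5 * exp 1 * (exp (- (1 / 4) * (norm (x - z))\<^sup>2) * norm (v z))"
        by (simp add: norm_mult mult_ac)
    qed
  qed measurable
  moreover have "(\<integral>z. u z * of_real (\<phi>' (?R i) z) \<partial>lborel) = - (\<integral>z. v z * of_real (\<phi> (?R i) z) \<partial>lborel)" for i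
    using uv[unfolded weak_partial_def, rule_format, OF test[of "?R i"]] by (simp add: deriv_\<phi>)
  ultimately show ?thesis
    unfolding E_def[symmetric] by (simp add: LIMSEQ_unique[OF _ tendsto_minus])
qed

section \<open>The operator \<open>X - iP\<close>\<close>

lemma X_cl_eq: "X_cl g x = (\<Sum>k\<in>UNIV. e_x k \<odot> (x $ k *\<^sub>R g x))"
proof -
  have "componentwise (X_op k) g x = x $ k *\<^sub>R g x" for k
    by (simp add: componentwise_def X_op_def vec_eq_iff scaleR_conv_of_real[where 'a = complex])
  then show ?thesis by (simp add: X_cl_def)
qed

lemma weak_gradient_exists:
  fixes g :: "'n rvec \<Rightarrow> ('n::{finite,linorder}, 'q::{finite,linorder}) cliff"
  assumes g: "g \<in> dom_X_minus_iP"
  obtains V where "\<And>k. V k \<in> L2C lborel" "\<And>k A. weak_partial k (\<lambda>z. g z $ A) (\<lambda>z. V k z $ A)"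
    "\<And>x. X_minus_iP g x = (\<Sum>k\<in>UNIV. e_x k \<odot> (x $ k *\<^sub>R g x - V k x))"
proof
  \<comment> \<open>The same choice term as in \<open>P_op\<close>, so the formula for X - iP holds
    at every point and not only almost everywhere.\<close>
  define v where "v k A = (SOME v. v \<in> L2 lborel \<and> weak_partial k (\<lambda>z. g z $ A) v)" for k A
  have v: "v k A \<in> L2 lborel \<and> weak_partial k (\<lambda>z. g z $ A) (v k A)" for k A
    unfolding v_def
    by (rule someI_ex[of "\<lambda>v. v \<in> L2 lborel \<and> weak_partial k (\<lambda>z. g z $ A) v"])
      (use g in \<open>auto simp: dom_X_minus_iP_def dom_P_def\<close>)
  define V where "V k z = (\<chi> A. v k A z)" for k z
  show "V k \<in> L2C lborel" for k using v by (simp add: L2C_def V_def)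
  show "weak_partial k (\<lambda>z. g z $ A) (\<lambda>z. V k z $ A)" for k A using v by (simp add: V_def)
  show "X_minus_iP g x = (\<Sum>k\<in>UNIV. e_x k \<odot> (x $ k *\<^sub>R g x - V k x))" for x
  proof -
    have "componentwise (P_op k) g x = (- \<i>) *s V k x" for k
      by (simp add: componentwise_def P_op_def V_def v_def vec_eq_iff)
    then have "\<i> *s P_cl g x = (\<Sum>k\<in>UNIV. e_x k \<odot> V k x)"
      by (simp only: P_cl_def cmult_scaleC_right smult.sum_right vector_smult_assoc) simp
    then show ?thesis
      by (simp add: X_minus_iP_def X_cl_eq cmult.diff_right sum_subtractf)
  qed
qed

lemma X_minus_iP_L2C:
  assumes g: "g \<in> dom_X_minus_iP"
  shows "X_minus_iP g \<in> L2C lborel"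
proof -
  obtain V where V: "\<And>k. V k \<in> L2C lborel" "\<And>k A. weak_partial k (\<lambda>z. g z $ A) (\<lambda>z. V k z $ A)"
    "\<And>x. X_minus_iP g x = (\<Sum>k\<in>UNIV. e_x k \<odot> (x $ k *\<^sub>R g x - V k x))"
    by (rule weak_gradient_exists[OF g]) (rule that)
  have Xg: "(\<lambda>x. x $ k *\<^sub>R g x) \<in> L2C lborel" for k
    using g by (simp add: L2C_def dom_X_minus_iP_def dom_X_def X_op_def[abs_def] scaleR_conv_of_real[where 'a = complex])
  have "(\<lambda>x. - V k x) \<in> L2C lborel" for k
    by (rule L2C_bounded_linear[OF bounded_linear_minus[OF bounded_linear_ident] V(1)])
  from L2C_add[OF Xg this] have "(\<lambda>x. x $ k *\<^sub>R g x - V k x) \<in> L2C lborel" for k by simp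
  then have "(\<lambda>x. \<Sum>k\<in>UNIV. e_x k \<odot> (x $ k *\<^sub>R g x - V k x)) \<in> L2C lborel"
    by (intro L2C_sum L2C_bounded_linear[OF cmult.bounded_linear_right])
  then show ?thesis by (simp add: V(3)[abs_def])
qed

text \<open>Differentiating the Gaussian in \<open>z\<^sub>k\<close> produces the factor \<open>x\<^sub>k - z\<^sub>k\<close>; its second summand
  cancels the contribution of \<open>X\<^sub>k\<close>.\<close>

lemma gauss_conv_X_minus_iP:
  fixes g :: "'n rvec \<Rightarrow> ('n::{finite,linorder}, 'q::{finite,linorder}) cliff"
  assumes g: "g \<in> L2C lborel" "g \<in> dom_X_minus_iP"
  shows "gauss_conv (\<lambda>_. 0) (X_minus_iP g) x = paravec x \<odot> gauss_conv (\<lambda>_. 0) g x"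
proof -
  obtain V where V: "\<And>k. V k \<in> L2C lborel" "\<And>k A. weak_partial k (\<lambda>z. g z $ A) (\<lambda>z. V k z $ A)"
    "\<And>x. X_minus_iP g x = (\<Sum>k\<in>UNIV. e_x k \<odot> (x $ k *\<^sub>R g x - V k x))"
    by (rule weak_gradient_exists[OF g(2)]) (rule that)
  let ?G = "\<lambda>z. gaussn_deriv (\<lambda>_. 0) (x - z)"
  have Xg: "(\<lambda>z. z $ k *\<^sub>R g z) \<in> L2C lborel" for k
    using g by (simp add: L2C_def dom_X_minus_iP_def dom_X_def X_op_def[abs_def] scaleR_conv_of_real[where 'a = complex])
  have comp: "(\<integral>z. ?G z *s w z \<partial>lborel) $ A = (\<integral>z. ?G z * w z $ A \<partial>lborel)"
    and comp_int: "integrable lborel (\<lambda>z. ?G z * w z $ A)"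
    if "w \<in> L2C lborel" for w :: "'n rvec \<Rightarrow> ('n, 'q) cliff" and A
    using integral_bounded_linear[OF bounded_linear_vec_nth[of A] integrable_gauss_conv[OF that]]
      integrable_bounded_linear[OF bounded_linear_vec_nth[of A] integrable_gauss_conv[OF that]]
    by simp_all
  \<comment> \<open>\<open>weak_partial\<close> concerns scalar functions, so the identity is
    checked on each blade coefficient.\<close>
  have parts: "(\<integral>z. ?G z *s (z $ k *\<^sub>R g z) \<partial>lborel) - (\<integral>z. ?G z *s V k z \<partial>lborel) = x $ k *\<^sub>R (\<integral>z. ?G z *s g z \<partial>lborel)" for k
  proof (subst vec_eq_iff, intro allI)
    fix A
    have "(\<lambda>z. g z $ A) \<in> L2 lborel" "(\<lambda>z. V k z $ A) \<in> L2 lborel"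
      using g V(1) by (auto simp: L2C_def)
    from weak_partial_gauss[OF this V(2), of x]
    have "(\<integral>z. ?G z * V k z $ A \<partial>lborel)
        = - (\<integral>z. of_real (x $ k) * (?G z * g z $ A) - ?G z * (z $ k *\<^sub>R g z) $ A \<partial>lborel)"
      by (simp add: gaussn_deriv_0 algebra_simps scaleR_conv_of_real[where 'a = complex])
    also have "\<dots> = (\<integral>z. ?G z * (z $ k *\<^sub>R g z) $ A \<partial>lborel) - of_real (x $ k) * (\<integral>z. ?G z * g z $ A \<partial>lborel)"
      using comp_int[OF g(1), of A] comp_int[OF Xg[of k], of A] by (subst Bochner_Integration.integral_diff) auto
    finally show "((\<integral>z. ?G z *s (z $ k *\<^sub>R g z) \<partial>lborel) - (\<integral>z. ?G z *s V k z \<partial>lborel)) $ A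
        = (x $ k *\<^sub>R (\<integral>z. ?G z *s g z \<partial>lborel)) $ A"
      by (simp only: vector_minus_component vector_scaleR_component comp[OF g(1)] comp[OF Xg] comp[OF V(1)]
          scaleR_conv_of_real[where 'a = complex]) simp
  qed
  have int: "integrable lborel (\<lambda>z. ?G z *s (z $ k *\<^sub>R g z) - ?G z *s V k z)" for k
    by (intro Bochner_Integration.integrable_diff integrable_gauss_conv Xg V(1))
  have "gauss_conv (\<lambda>_. 0) (X_minus_iP g) x
      = (\<integral>z. (\<Sum>k\<in>UNIV. e_x k \<odot> (?G z *s (z $ k *\<^sub>R g z) - ?G z *s V k z)) \<partial>lborel)"
    by (simp only: gauss_conv_def V(3) smult.sum_right smult.diff_right cmult_scaleC_right cmult.diff_right)
  also have "\<dots> = (\<Sum>k\<in>UNIV. e_x k \<odot> (\<integral>z. ?G z *s (z $ k *\<^sub>R g z) - ?G z *s V k z \<partial>lborel))"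
    by (subst Bochner_Integration.integral_sum)
      (simp_all only: integrable_bounded_linear[OF cmult.bounded_linear_right int]
        integral_bounded_linear[OF cmult.bounded_linear_right int])
  also have "\<dots> = (\<Sum>k\<in>UNIV. e_x k \<odot> (x $ k *\<^sub>R gauss_conv (\<lambda>_. 0) g x))"
    by (simp only: Bochner_Integration.integral_diff[OF integrable_gauss_conv[OF Xg] integrable_gauss_conv[OF V(1)]]
        parts gauss_conv_def)
  also have "\<dots> = paravec x \<odot> gauss_conv (\<lambda>_. 0) g x"
    by (simp add: paravec_def cmult.sum_left cmult.scaleR_left cmult.scaleR_right)
  finally show ?thesis .
qed

text \<open>The function g represents the preimage of f under U. Since \<open>CK\<close> is a
  \<open>suminf\<close>, convergence of the series and analyticity of its initial function are
  asserted separately, so that the right-hand side is a genuine CK-extension.\<close>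

theorem theorem7p1:
  fixes f :: "('n, 'q) point \<Rightarrow> ('n::{finite,linorder}, 'q::{finite,linorder}) cliff"
    and g :: "'n rvec \<Rightarrow> ('n, 'q) cliff"
  assumes "f \<in> GSML2"
    and "g \<in> L2C lborel" and "SB g = f"
    and "g \<in> dom_X_minus_iP"
  shows "real_analytic (\<lambda>x. paravec x \<odot> f (x, 0))
    \<and> (\<forall>z. summable (CK_term (\<lambda>x. paravec x \<odot> f (x, 0)) z))
    \<and> (\<forall>z. SB (X_minus_iP g) z = CK (\<lambda>x. paravec x \<odot> f (x, 0)) z)"
proof -
  let ?h = "X_minus_iP g"
  have h: "?h \<in> L2C lborel" using assms(4) by (rule X_minus_iP_L2C)
  \<comment> \<open>An equality of functions on all of the x-space: the derivatives inside
    \<open>CK_term\<close> require more than agreement at one point.\<close>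
  have fx: "(\<lambda>x. paravec x \<odot> f (x, 0)) = (\<lambda>x. SB ?h (x, 0))"
    using assms by (auto simp: SB_restriction[OF h] SB_restriction gauss_conv_X_minus_iP cmult.scaleR_right)
  have "real_analytic (\<lambda>x. SB ?h (x, 0))"
    unfolding SB_restriction[OF h] by (rule real_analytic_gauss_conv[OF h])
  moreover have "CK_term (\<lambda>x. SB ?h (x, 0)) z sums SB ?h z" for z
    by (rule SB_CK[OF h])
  ultimately show ?thesis
    unfolding fx CK_def by (auto simp: sums_iff)
qed

end
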